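(* Let $G=\frac1n\sum_{i=1}^nG_i$ satisfy, for some $L\in(0,+\infty)$ and all $x,y\in\mathbb{R}^p$, $$\frac1n\sum_{i=1}^n\langle G_ix-G_iy,x-y\rangle\ \ge\ \frac1L\Big[\frac1n\sum_{i=1}^n\|G_ix-G_iy\|^2\Big],$$ and let $G$ be $\sigma$-strongly quasi-monotone, i.e. there exist $x^\star\in\mathrm{zer}(G)$ and $\sigma>0$ such that $\langle Gx,x-x^\star\rangle\ge\sigma\|x-x^\star\|^2$ for all $x\in\mathrm{dom}(G)$. Let $\rho\in(0,1)$, $\Theta>0$, $\hat\Theta\ge0$ be the constants of the variance-reduced unbiased estimator used below, define $$\kappa:=\frac L\sigma,\quad \Gamma:=\rho+2(\Theta+\hat\Theta),\quad M:=2(2\Gamma-1)\kappa,\quad N:=3\Gamma\kappa+2(1-2\rho),$$ and suppose that $N^2+12\rho M\ge0$ and $2\rho<1$. Let $$\bar\beta:=\frac1\sigma\min\Big\{\frac35,\ \frac{3\rho}{2(1-2\rho)},\ \frac1{2\kappa},\ \frac{6\rho}{N+\sqrt{N^2+12\rho M}}\Big\}>0.$$ Let $\{x^k\}$ be generated by the method (VFKM) described in the context to solve $Gx=0$, using a variance-reduced unbiased estimator $\widetilde S^k$ of $S^k$ and the fixed parameters $$\theta_k=\theta:=\tfrac13,\qquad\gamma_k=\gamma:=\tfrac12,\qquad\eta_k=\eta:=\beta\in(0,\bar\beta).$$ Then, with $\omega:=\frac{2\beta\sigma}{3+4\beta\sigma}\in(0,1/2)$, we have $$\mathbb{E}\big[\|x^k-x^\star\|^2\big]\le4(1+2L^2\beta^2)(1-\omega)^k\|x^0-x^\star\|^2.$$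 Consequently, for a given tolerance $\epsilon>0$, (VFKM) requires $k=\mathcal{O}\big(\big(2+\frac{3}{2\beta\sigma}\big)\log(\epsilon^{-1})\big)$ iterations to achieve an $\epsilon$-solution $x^k$ such that $\mathbb{E}[\|x^k-x^\star\|^2]\le\epsilon^2$.
   Context: Setting. $n,p\ge1$ are integers, $G_i:\mathbb{R}^p\to\mathbb{R}^p$ ($i=1,\dots,n$) are single-valued mappings, $Gx:=\frac1n\sum_{i=1}^nG_ix$ (so $\mathrm{dom}(G)=\mathbb{R}^p$), and $\mathrm{zer}(G):=\{x^\star\in\mathbb{R}^p: Gx^\star=0\}$. Method (VFKM). Given $x^0\in\mathrm{dom}(G)$, set $x^{-1}:=x^0$. At each iteration $k\ge0$, let $S^k:=Gx^k-\gamma_kGx^{k-1}$, construct an unbiased variance-reduced estimator $\widetilde S^k$ of $S^k$ (with $\widetilde S^0:=S^0$), and update $x^{k+1}:=x^k+\theta_k(x^k-x^{k-1})-\eta_k\widetilde S^k$. Variance-reduced unbiased estimator. $\mathcal{F}_k$ is the $\sigma$-algebra containing all the information generated by the algorithm (including $x^0,\dots,x^k$) up to iteration $k$ before constructing $\widetilde S^k$; $\mathbb{E}_k[\cdot]:=\mathbb{E}[\cdot\mid\mathcal{F}_k]$, and $\mathbb{E}$ is the total expectation. A stochastic estimator $\widetilde S^k$ of $S^k$, constructed using fresh randomness conditionally on $\mathcal{F}_k$, is a variance-reduced unbiased estimator of $S^k$ if there exist $\rho\in(0,1)$, $\Theta>0$, $\hat\Theta\ge0$ and a nonnegative random sequence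 $\{\Delta_k\}$ such that, for all $k\ge1$, almost surely: $\mathbb{E}_k[\widetilde S^k-S^k]=0$; $\mathbb{E}_k[\|\widetilde S^k-S^k\|^2]\le\mathbb{E}_k[\Delta_k]$; and $$\tfrac{1}{(1-\gamma_k)^2}\mathbb{E}_k[\Delta_k]\le\tfrac{1-\rho}{(1-\gamma_{k-1})^2}\Delta_{k-1}+\tfrac{\Theta}{(1-\gamma_k)^2}U_k+\tfrac{\hat\Theta}{(1-\gamma_{k-1})^2}U_{k-1},$$ where $U_k:=\frac1n\sum_{i=1}^n\|G_ix^k-G_ix^{k-1}\|^2$, $x^{-2}=x^{-1}=x^0$, and $\gamma_{-1}=\gamma_0\in[0,1)$.
   Formalization: The formal statement additionally requires Δ_0 = 0 almost surely for the variance-reduced estimator; with Δ_0 unrestricted the claim fails (e.g. x^0 = x^⋆ with a noisy S̃^1 makes E‖x^2−x^⋆‖² > 0 while the bound is 0). *)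

theory Defs
  imports "HOL-Probability.Probability"
begin

(* Index convention used throughout: time indices are natural numbers and subtraction on nat
   truncates, so  k - 1 = 0  at  k = 0.  Hence  x (k - 1)  and  gamma (k - 1)  encode exactly the
   conventions  x^(-2) = x^(-1) = x^0  and  gamma_(-1) = gamma_0. *)

definition avg_map :: "nat \<Rightarrow> (nat \<Rightarrow> real^'p \<Rightarrow> real^'p) \<Rightarrow> real^'p \<Rightarrow> real^'p" where
  "avg_map n G x = (1 / real n) *\<^sub>R (\<Sum>i = 1..n. G i x)"

definition zer :: "(real^'p \<Rightarrow> real^'p) \<Rightarrow> (real^'p) set" where
  "zer T = {x. T x = 0}"

definition avg_cocoercive :: "nat \<Rightarrow> (nat \<Rightarrow> real^'p \<Rightarrow> real^'p) \<Rightarrow> real \<Rightarrow> bool" where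
  "avg_cocoercive n G L \<longleftrightarrow>
     (\<forall>x y. (1 / real n) * (\<Sum>i = 1..n. (G i x - G i y) \<bullet> (x - y))
              \<ge> (1 / L) * ((1 / real n) * (\<Sum>i = 1..n. (norm (G i x - G i y))\<^sup>2)))"

definition strongly_quasi_monotone_at ::
    "(real^'p \<Rightarrow> real^'p) \<Rightarrow> real \<Rightarrow> real^'p \<Rightarrow> bool" where
  "strongly_quasi_monotone_at T \<sigma> xstar \<longleftrightarrow>
     xstar \<in> zer T \<and> 0 < \<sigma> \<and> (\<forall>x. T x \<bullet> (x - xstar) \<ge> \<sigma> * (norm (x - xstar))\<^sup>2)"

definition vfkm_S ::
    "(real^'p \<Rightarrow> real^'p) \<Rightarrow> (nat \<Rightarrow> real) \<Rightarrow> (nat \<Rightarrow> 'w \<Rightarrow> real^'p) \<Rightarrow> nat \<Rightarrow> 'w \<Rightarrow> real^'p" where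
  "vfkm_S T \<gamma> x k w = T (x k w) - \<gamma> k *\<^sub>R T (x (k - 1) w)"

(* x0 is a deterministic starting point; St k is the estimator of vfkm_S at iteration k. *)
definition vfkm ::
    "'w measure \<Rightarrow> (real^'p \<Rightarrow> real^'p) \<Rightarrow> (nat \<Rightarrow> real) \<Rightarrow> (nat \<Rightarrow> real) \<Rightarrow> (nat \<Rightarrow> real) \<Rightarrow>
     real^'p \<Rightarrow> (nat \<Rightarrow> 'w \<Rightarrow> real^'p) \<Rightarrow> (nat \<Rightarrow> 'w \<Rightarrow> real^'p) \<Rightarrow> bool" where
  "vfkm P T \<theta> \<gamma> \<eta> x0 x St \<longleftrightarrow>
     (\<forall>w\<in>space P.
        x 0 w = x0 \<and>
        St 0 w = vfkm_S T \<gamma> x 0 w \<and>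
        (\<forall>k. x (Suc k) w = x k w + \<theta> k *\<^sub>R (x k w - x (k - 1) w) - \<eta> k *\<^sub>R St k w))"

definition algorithm_filtration ::
    "'w measure \<Rightarrow> (nat \<Rightarrow> 'w measure) \<Rightarrow> (nat \<Rightarrow> 'w \<Rightarrow> real^'p) \<Rightarrow> bool" where
  "algorithm_filtration P F x \<longleftrightarrow>
     filtration (space P) F \<and> (\<forall>k. subalgebra P (F k)) \<and> (\<forall>k. x k \<in> borel_measurable (F k))"

definition vr_U ::
    "nat \<Rightarrow> (nat \<Rightarrow> real^'p \<Rightarrow> real^'p) \<Rightarrow> (nat \<Rightarrow> 'w \<Rightarrow> real^'p) \<Rightarrow> nat \<Rightarrow> 'w \<Rightarrow> real" where
  "vr_U n G x k w = (1 / real n) * (\<Sum>i = 1..n. (norm (G i (x k w) - G i (x (k - 1) w)))\<^sup>2)"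

(* The conditional expectation of the vector-valued error is taken coordinatewise.  Those of the
   nonnegative quantities are taken as extended nonnegative reals (nn_cond_exp), which needs no
   integrability assumption; the third inequality makes them finite almost surely, so the
   coordinatewise real_cond_exp in the unbiasedness condition never takes a junk value.

   Since the estimator is exact at iteration 0 (St 0 = S^0), the sequence Delta starts at 0.
   Equivalently, the third inequality also holds at k = 0 with Delta_(-1) = 0, as
   U_0 = U_(-1) = 0.  With an arbitrary Delta_0 the estimator error at iteration 1 would not be
   controlled by the starting point. *)
definition vr_unbiased_estimator ::
    "'w measure \<Rightarrow> (nat \<Rightarrow> 'w measure) \<Rightarrow> nat \<Rightarrow> (nat \<Rightarrow> real^'p \<Rightarrow> real^'p) \<Rightarrow> (nat \<Rightarrow> real) \<Rightarrow>
     (nat \<Rightarrow> 'w \<Rightarrow> real^'p) \<Rightarrow> (nat \<Rightarrow> 'w \<Rightarrow> real^'p) \<Rightarrow> real \<Rightarrow> real \<Rightarrow> real \<Rightarrow> bool" where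
  "vr_unbiased_estimator P F n G \<gamma> x St \<rho> \<Theta> \<Theta>h \<longleftrightarrow>
     0 < \<rho> \<and> \<rho> < 1 \<and> 0 < \<Theta> \<and> 0 \<le> \<Theta>h \<and>
     (\<forall>k. St k \<in> borel_measurable P) \<and>
     (\<exists>\<Delta> :: nat \<Rightarrow> 'w \<Rightarrow> real.
        (\<forall>k. \<Delta> k \<in> borel_measurable P) \<and>
        (\<forall>k. AE w in P. 0 \<le> \<Delta> k w) \<and>
        (AE w in P. \<Delta> 0 w = 0) \<and>
        (\<forall>k\<ge>1.
           (\<forall>j. AE w in P.
              real_cond_exp P (F k) (\<lambda>w. (St k w - vfkm_S (avg_map n G) \<gamma> x k w) $ j) w = 0) \<and>
           (AE w in P.
              nn_cond_exp P (F k)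
                (\<lambda>w. ennreal ((norm (St k w - vfkm_S (avg_map n G) \<gamma> x k w))\<^sup>2)) w
              \<le> nn_cond_exp P (F k) (\<lambda>w. ennreal (\<Delta> k w)) w) \<and>
           (AE w in P.
              ennreal (1 / (1 - \<gamma> k)\<^sup>2) * nn_cond_exp P (F k) (\<lambda>w. ennreal (\<Delta> k w)) w
              \<le> ennreal ((1 - \<rho>) / (1 - \<gamma> (k - 1))\<^sup>2 * \<Delta> (k - 1) w
                        + \<Theta> / (1 - \<gamma> k)\<^sup>2 * vr_U n G x k w
                        + \<Theta>h / (1 - \<gamma> (k - 1))\<^sup>2 * vr_U n G x (k - 1) w))))"

end

theory Submission
  imports Defs
begin

text \<open>The method is a gradient-like iteration with momentum, and the momentum can be transformed away. Let
\<open>a\<close> be the deviation of the iterate from the solution, \<open>v\<close> the last increment, and \<open>g\<close>, \<open>h\<close> the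
operator at the current and at the previous iterate, scaled by \<open>\<beta>\<close>. For the momentum \<open>1/3\<close> and the
reflection \<open>1/2\<close>, the combination \<open>u = a + v/2 + 3h/4\<close> moves, without noise, to \<open>u - 3g/4\<close>. Hence
\<open>\<parallel>u\<parallel>\<^sup>2\<close> decreases through \<open>g \<bullet> a\<close>, which strong quasi-monotonicity and cocoercivity bound below.
Two corrections turn it into the Lyapunov function \<open>lyap\<close>: a multiple of \<open>h \<bullet> v\<close>, chosen so that the
increment meets the operator only in \<open>(g - h) \<bullet> v \<ge> \<beta> U\<^sub>k / L\<close>, and a multiple of
\<open>\<parallel>v\<parallel>\<^sup>2\<close>, so that \<open>\<parallel>a\<parallel>\<^sup>2\<close> is bounded by twice its value. A noise-free step then contracts
\<open>lyap\<close> by \<open>1 - \<omega>\<close> and leaves a surplus \<open>11/8 (\<beta>/L - \<beta>\<^sup>2) U\<^sub>k\<close> (\<open>lyap_decrease\<close>).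

The noise of the estimator is conditionally centered, so in expectation it adds only \<open>11/4 \<beta>\<^sup>2\<close> times its variance
(\<open>lyap_noise\<close>, \<open>integral_inner_centered\<close>). The variance is dominated by \<open>\<Delta>\<^sub>k\<close>, which itself
contracts by \<open>1 - \<rho>\<close> up to terms in \<open>U\<^sub>k\<close> and \<open>U\<^sub>k\<^sub>-\<^sub>1\<close>. Adding \<open>\<Delta>\<close> and \<open>U\<close> of the previous
iteration to the expected Lyapunov function, with a weight proportional to \<open>\<beta>\<^sup>2 / (\<rho> - \<omega>)\<close>, gives a
potential that contracts by \<open>1 - \<omega>\<close>, provided that the surplus pays for all terms in \<open>U\<^sub>k\<close>:
\<open>2 \<beta>\<^sup>2 (\<Theta> + \<Theta>h) / (\<rho> - \<omega>) \<le> \<beta>/L - \<beta>\<^sup>2\<close>. For \<open>\<omega> = 2 \<beta> \<sigma> / (3 + 4 \<beta> \<sigma>)\<close> this is a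
quadratic inequality in \<open>\<beta> \<sigma>\<close>, and the last term in the minimum defining the step-size limit is its smallest positive root
(\<open>step_size_condition\<close>). The other terms of the minimum ensure \<open>\<omega> \<le> 2/9\<close>, \<open>\<omega> < \<rho>\<close> and
\<open>\<beta> L \<le> 1/2\<close>.

The complexity bound follows from \<open>1 / \<omega> = 2 + 3 / (2 \<beta> \<sigma>)\<close>.\<close>

section \<open>The step-size condition\<close>

text \<open>With \<open>s = \<beta> \<sigma>\<close> and \<open>\<kappa> s = L \<beta>\<close>, the second conclusion says that the variance accumulated over all
later iterations, whose geometric weight is \<open>1 / (\<rho> - \<omega>)\<close>, costs at most what cocoercivity
provides. Multiplied by \<open>3 + 4 s\<close> it is the quadratic inequality \<open>M s\<^sup>2 + N s \<le> 3 \<rho>\<close>, which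
explains the shape of \<open>M\<close>, \<open>N\<close> and of the root.\<close>
lemma step_size_condition:
  fixes s \<kappa> \<rho> \<Theta>s \<omega> :: real
  defines "\<Gamma> \<equiv> \<rho> + 2 * \<Theta>s"
  defines "M \<equiv> 2 * (2 * \<Gamma> - 1) * \<kappa>"
  defines "N \<equiv> 3 * \<Gamma> * \<kappa> + 2 * (1 - 2 * \<rho>)"
  assumes s: "0 < s" and \<kappa>: "0 < \<kappa>" and \<rho>: "0 < \<rho>" "2 * \<rho> < 1" and \<Theta>s: "0 < \<Theta>s"
    and disc: "0 \<le> N\<^sup>2 + 12 * \<rho> * M"
    and s_root: "s < 6 * \<rho> / (N + sqrt (N\<^sup>2 + 12 * \<rho> * M))"
    and s_rho: "s < 3 * \<rho> / (2 * (1 - 2 * \<rho>))"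
    and \<omega>: "\<omega> = 2 * s / (3 + 4 * s)"
  shows "\<omega> < \<rho>" and "\<kappa> * s * (\<rho> - \<omega> + 2 * \<Theta>s) \<le> \<rho> - \<omega>"
proof -
  have den: "0 < 3 + 4 * s" using s by simp
  have "2 * s * (1 - 2 * \<rho>) < 3 * \<rho>"
    using s_rho \<rho> by (simp add: field_simps)
  then show "\<omega> < \<rho>"
    unfolding \<omega> using den by (simp add: field_simps)
  \<comment> \<open>The bound on \<open>s\<close> involving the square root is the smallest positive root of
    \<open>M s\<^sup>2 + N s - 3 \<rho>\<close> in rationalised form, valid for either sign of \<open>M\<close>. Multiplying
    by \<open>12 \<rho>\<close> rather than by \<open>M\<close> keeps the sign when \<open>M \<le> 0\<close>.\<close>
  define R where "R = sqrt (N\<^sup>2 + 12 * \<rho> * M)"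
  have R0: "0 \<le> R" and R2: "R\<^sup>2 = N\<^sup>2 + 12 * \<rho> * M"
    using disc by (simp_all add: R_def)
  have N0: "0 < N"
    unfolding N_def \<Gamma>_def using \<kappa> \<rho> \<Theta>s by (intro add_pos_pos mult_pos_pos) auto
  have sum_lt: "N * s + R * s < 6 * \<rho>"
    using s_root N0 R0 unfolding R_def[symmetric] by (simp add: pos_less_divide_eq algebra_simps)
  have Ns: "N * s < 6 * \<rho>"
    using sum_lt mult_nonneg_nonneg[OF R0 less_imp_le[OF s]] by linarith
  have factored: "12 * \<rho> * (M * s\<^sup>2 + N * s - 3 * \<rho>) = (R * s - N * s + 6 * \<rho>) * (R * s + N * s - 6 * \<rho>)"
  proof -
    have "(R * s - N * s + 6 * \<rho>) * (R * s + N * s - 6 * \<rho>) = R\<^sup>2 * s\<^sup>2 - (N * s - 6 * \<rho>)\<^sup>2"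
      by (simp add: power2_eq_square algebra_simps)
    then show ?thesis unfolding R2 by (simp add: power2_eq_square algebra_simps)
  qed
  have "(R * s - N * s + 6 * \<rho>) * (R * s + N * s - 6 * \<rho>) < 0"
    using sum_lt Ns mult_nonneg_nonneg[OF R0 less_imp_le[OF s]]
    by (intro mult_pos_neg) linarith+
  then have "12 * \<rho> * (M * s\<^sup>2 + N * s - 3 * \<rho>) < 0" unfolding factored .
  then have quad: "M * s\<^sup>2 + N * s - 3 * \<rho> < 0"
    using \<rho> by (simp add: mult_less_0_iff)
  have wd: "\<omega> * (3 + 4 * s) = 2 * s" using den by (simp add: \<omega>)
  have "(3 + 4 * s) * (\<kappa> * s * (\<rho> - \<omega> + 2 * \<Theta>s) - (\<rho> - \<omega>)) = M * s\<^sup>2 + N * s - 3 * \<rho>"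
    using wd unfolding M_def N_def \<Gamma>_def by algebra
  then have "(3 + 4 * s) * (\<kappa> * s * (\<rho> - \<omega> + 2 * \<Theta>s) - (\<rho> - \<omega>)) < 0" using quad by simp
  then show "\<kappa> * s * (\<rho> - \<omega> + 2 * \<Theta>s) \<le> \<rho> - \<omega>"
    using den by (simp add: mult_less_0_iff)
qed

section \<open>A Lyapunov function for one step\<close>

text \<open>The arguments are the deviation \<open>a\<close> of the iterate from the solution, the last increment \<open>v\<close>, and
the operator value \<open>h\<close> at the previous iterate, scaled by the step size. The combination
\<open>u = a + v/2 + 3h/4\<close> removes the momentum: a noise-free step \<open>v' = v/3 - g + h/2\<close> turns it into
\<open>u - 3g/4\<close>. The term in \<open>v\<close> alone makes the form control \<open>a\<close>. The coefficient \<open>-11/8\<close> is then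
the only one for which, in the change \<open>lyap a v h - lyap a' v' g\<close>, the inner products of \<open>v\<close> with
\<open>g\<close> and \<open>h\<close> combine into a multiple of \<open>(g - h) \<bullet> v\<close>, which is what cocoercivity
between consecutive iterates controls.\<close>
definition lyap :: "'a::real_inner \<Rightarrow> 'a \<Rightarrow> 'a \<Rightarrow> real" where
  "lyap a v h = (norm (a + (1/2) *\<^sub>R v + (3/4) *\<^sub>R h))\<^sup>2 - (11/8) * (h \<bullet> v) + (1/2) * (norm v)\<^sup>2"

lemmas expand_inner = lyap_def power2_norm_eq_inner inner_add_left inner_add_right
  inner_diff_left inner_diff_right inner_commute

text \<open>The form is not positive definite: its cross terms in \<open>h\<close> can make it negative. The hypothesis, which is
cocoercivity between the previous iterate (with deviation \<open>a - v\<close>) and the solution, compensates them.\<close>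
lemma lyap_ge:
  fixes a v h :: "'a::real_inner"
  assumes "2 * (norm h)\<^sup>2 \<le> h \<bullet> (a - v)"
  shows "(norm a)\<^sup>2 \<le> 2 * lyap a v h"
proof -
  have "lyap a v h - (1/2) * (norm a)\<^sup>2 - (h \<bullet> (a - v) - 2 * (norm h)\<^sup>2)
      = (3/4) * (norm (v + (2/3) *\<^sub>R a + (1/4) *\<^sub>R h))\<^sup>2
        + (161/64) * (norm (h + (8/161) *\<^sub>R a))\<^sup>2 + (155/966) * (norm a)\<^sup>2"
    by (simp add: expand_inner, simp add: field_simps)
  moreover have "0 \<le> (3/4) * (norm (v + (2/3) *\<^sub>R a + (1/4) *\<^sub>R h))\<^sup>2
        + (161/64) * (norm (h + (8/161) *\<^sub>R a))\<^sup>2 + (155/966) * (norm a)\<^sup>2"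
    by simp
  ultimately show ?thesis using assms by linarith
qed

text \<open>The increment is zero at the start, and \<open>h\<close> is then the operator at the starting point, so that
the Lipschitz bound applies with \<open>y = L \<beta>\<close>.\<close>
lemma lyap_start:
  fixes a h :: "'a::real_inner"
  assumes "norm h \<le> y * norm a"
  shows "lyap a 0 h \<le> 2 * (1 + 2 * y\<^sup>2) * (norm a)\<^sup>2"
proof -
  have "lyap a 0 h = 2 * (norm a)\<^sup>2 + (9/8) * (norm h)\<^sup>2 - (norm (a - (3/4) *\<^sub>R h))\<^sup>2"
    by (simp add: expand_inner)
  also have "\<dots> \<le> 2 * (norm a)\<^sup>2 + 4 * (norm h)\<^sup>2"
    by (rule order.trans[OF diff_right_mono[of _ "2 * (norm a)\<^sup>2 + 4 * (norm h)\<^sup>2"]]) auto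
  also have "(norm h)\<^sup>2 \<le> y\<^sup>2 * (norm a)\<^sup>2"
    using power_mono[OF assms, of 2] by (simp add: power_mult_distrib)
  finally show ?thesis by (simp add: algebra_simps)
qed

text \<open>The noise-free step. The three hypotheses on \<open>g\<close> are strong quasi-monotonicity, cocoercivity at the solution and
cocoercivity between consecutive iterates; \<open>\<tau>\<close> stands for \<open>\<beta>\<^sup>2 U\<^sub>k\<close> and \<open>t\<close> for
\<open>\<beta> U\<^sub>k / L\<close>. The surplus \<open>11/8 (t - \<tau>)\<close> is kept in the conclusion because it has to pay
for the variance of the estimator.\<close>
lemma lyap_decrease:
  fixes a v h g :: "'a::real_inner"
  defines "v' \<equiv> (1/3) *\<^sub>R v - g + (1/2) *\<^sub>R h"
  assumes \<omega>: "0 \<le> \<omega>" "\<omega> \<le> 2/9"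
    and mono: "(3/2) * \<omega> * (norm a)\<^sup>2 \<le> g \<bullet> a"
    and coc: "2 * (norm g)\<^sup>2 \<le> g \<bullet> a"
    and inc: "t \<le> (g - h) \<bullet> v" and t: "2 * \<tau> \<le> t" and \<tau>: "(norm (g - h))\<^sup>2 \<le> \<tau>"
  shows "lyap (a + v') v' g + (11/8) * (t - \<tau>) \<le> (1 - \<omega>) * lyap a v h"
proof -
  \<comment> \<open>Subtracting the hypotheses with the weights \<open>1\<close> (monotonicity), \<open>1/2\<close> (cocoercivity) and
    \<open>37/24 = 11/8 + 1/6\<close> (increment), and adding \<open>41/24 = 11/8 + 1/3\<close> times \<open>\<parallel>g - h\<parallel>\<^sup>2\<close>, leaves
    a quadratic form in \<open>a, v, h, g\<close>. \<open>S\<close> is that form as a sum of squares, whose coefficients are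
    nonnegative for \<open>0 \<le> \<omega> \<le> 2/9\<close>. The extra \<open>1/6\<close> and \<open>1/3\<close> balance because \<open>t \<ge> 2 \<tau>\<close>.\<close>
  define S where "S = (\<omega>/2) * (norm (a - v - (3/2) *\<^sub>R h))\<^sup>2
      + (7/24) * \<omega> * (norm ((3/2) *\<^sub>R v - h))\<^sup>2
      + (4/9 - (61/32) * \<omega>) * (norm v)\<^sup>2
      + (13/48) * (norm (g - (53/26) *\<^sub>R h))\<^sup>2
      + (19/12 - 2809/2496 - (95/48) * \<omega>) * (norm h)\<^sup>2"
  have "0 \<le> S"
    unfolding S_def using \<omega> by (intro add_nonneg_nonneg mult_nonneg_nonneg) auto
  moreover have "(1 - \<omega>) * lyap a v h - lyap (a + v') v' g
      = (37/24) * ((g - h) \<bullet> v) - (41/24) * (norm (g - h))\<^sup>2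
        + (g \<bullet> a - (3/2) * \<omega> * (norm a)\<^sup>2) + (1/2) * (g \<bullet> a - 2 * (norm g)\<^sup>2) + S"
    unfolding v'_def S_def by (simp add: expand_inner, simp add: field_simps)
  ultimately show ?thesis using mono coc inc t \<tau> by argo
qed

text \<open>The noise enters quadratically with coefficient \<open>11/4 = (3/2)\<^sup>2 + 1/2\<close>, twice the factor of the
surplus in the noise-free step. This ratio is what produces the step-size bound.\<close>
lemma lyap_noise:
  fixes a v g e :: "'a::real_inner"
  shows "lyap (a + (v - e)) (v - e) g
    = lyap (a + v) v g - e \<bullet> (3 *\<^sub>R a + (11/2) *\<^sub>R v + (7/8) *\<^sub>R g) + (11/4) * (norm e)\<^sup>2"
  by (simp add: expand_inner, simp add: field_simps)

section \<open>Square integrability and centered noise\<close>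

text \<open>Bundling measurability with integrability of the squared norm gives a class that is closed under linear
operations and in which inner products are integrable, hence so is the Lyapunov function.\<close>
definition sq_integrable :: "'w measure \<Rightarrow> ('w \<Rightarrow> 'a::euclidean_space) \<Rightarrow> bool" where
  "sq_integrable M f \<longleftrightarrow> f \<in> borel_measurable M \<and> integrable M (\<lambda>w. (norm (f w))\<^sup>2)"

lemma sq_integrable_bounded_by:
  assumes f: "sq_integrable M f" and [measurable]: "g \<in> borel_measurable M"
    and le: "\<And>w. w \<in> space M \<Longrightarrow> norm (g w) \<le> c * norm (f w)"
  shows "sq_integrable M g"
proof -
  have "integrable M (\<lambda>w. (norm (g w))\<^sup>2)"
  proof (rule Bochner_Integration.integrable_bound)
    show "integrable M (\<lambda>w. c\<^sup>2 * (norm (f w))\<^sup>2)"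
      using f by (auto simp: sq_integrable_def)
    show "AE w in M. norm ((norm (g w))\<^sup>2) \<le> norm (c\<^sup>2 * (norm (f w))\<^sup>2)"
    proof (rule AE_I2)
      fix w assume "w \<in> space M"
      from power_mono[OF le[OF this], of 2]
      show "norm ((norm (g w))\<^sup>2) \<le> norm (c\<^sup>2 * (norm (f w))\<^sup>2)"
        by (simp add: power_mult_distrib)
    qed
  qed simp
  then show ?thesis by (simp add: sq_integrable_def)
qed

lemma sq_integrable_scaleR:
  assumes "sq_integrable M f" shows "sq_integrable M (\<lambda>w. c *\<^sub>R f w)"
proof (rule sq_integrable_bounded_by[OF assms])
  show "(\<lambda>w. c *\<^sub>R f w) \<in> borel_measurable M"
    using assms unfolding sq_integrable_def by (intro borel_measurable_scaleR) simp_all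
  show "norm (c *\<^sub>R f w) \<le> \<bar>c\<bar> * norm (f w)" for w by simp
qed

lemma sq_integrable_add:
  assumes f: "sq_integrable M f" and g: "sq_integrable M g"
  shows "sq_integrable M (\<lambda>w. f w + g w)"
proof -
  have [measurable]: "f \<in> borel_measurable M" "g \<in> borel_measurable M"
    using f g by (auto simp: sq_integrable_def)
  have "integrable M (\<lambda>w. (norm (f w + g w))\<^sup>2)"
  proof (rule Bochner_Integration.integrable_bound)
    show "integrable M (\<lambda>w. 2 * (norm (f w))\<^sup>2 + 2 * (norm (g w))\<^sup>2)"
      using f g by (auto simp: sq_integrable_def)
    have "(norm (f w + g w))\<^sup>2 = 2 * (norm (f w))\<^sup>2 + 2 * (norm (g w))\<^sup>2 - (norm (f w - g w))\<^sup>2" for w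
      by (simp add: power2_norm_eq_inner inner_add_left inner_add_right
          inner_diff_left inner_diff_right inner_commute)
    then have "(norm (f w + g w))\<^sup>2 \<le> 2 * (norm (f w))\<^sup>2 + 2 * (norm (g w))\<^sup>2" for w
      by simp
    then show "AE w in M. norm ((norm (f w + g w))\<^sup>2) \<le> norm (2 * (norm (f w))\<^sup>2 + 2 * (norm (g w))\<^sup>2)"
      by simp
  qed simp
  then show ?thesis by (simp add: sq_integrable_def)
qed

lemma sq_integrable_diff:
  assumes "sq_integrable M f" "sq_integrable M g"
  shows "sq_integrable M (\<lambda>w. f w - g w)"
proof -
  have "f w - g w = f w + (-1) *\<^sub>R g w" for w by simp
  then have "(\<lambda>w. f w - g w) = (\<lambda>w. f w + (-1) *\<^sub>R g w)" by (rule ext)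
  then show ?thesis
    using sq_integrable_add[OF assms(1) sq_integrable_scaleR[OF assms(2), of "-1"]] by (simp only:)
qed

lemma sq_integrable_inner:
  assumes f: "sq_integrable M f" and g: "sq_integrable M g"
  shows "integrable M (\<lambda>w. f w \<bullet> g w)"
proof -
  have polarization: "f w \<bullet> g w = (1/4) * ((norm (f w + g w))\<^sup>2 - (norm (f w - g w))\<^sup>2)" for w
    by (simp add: power2_norm_eq_inner inner_add_left inner_add_right
          inner_diff_left inner_diff_right inner_commute)
  have "integrable M (\<lambda>w. (norm (f w + g w))\<^sup>2)" and "integrable M (\<lambda>w. (norm (f w - g w))\<^sup>2)"
    using sq_integrable_add[OF f g] sq_integrable_diff[OF f g] by (simp_all add: sq_integrable_def)
  from Bochner_Integration.integrable_diff[OF this]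
  show ?thesis unfolding polarization by (rule integrable_mult_right)
qed

lemma sq_integrable_lyap:
  assumes "sq_integrable M a" "sq_integrable M v" "sq_integrable M h"
  shows "integrable M (\<lambda>w. lyap (a w) (v w) (h w))"
proof -
  have "sq_integrable M (\<lambda>w. a w + (1/2) *\<^sub>R v w + (3/4) *\<^sub>R h w)"
    by (rule sq_integrable_add[OF sq_integrable_add[OF assms(1)
        sq_integrable_scaleR[OF assms(2)]] sq_integrable_scaleR[OF assms(3)]])
  then have position: "integrable M (\<lambda>w. (norm (a w + (1/2) *\<^sub>R v w + (3/4) *\<^sub>R h w))\<^sup>2)"
    unfolding sq_integrable_def by (rule conjunct2)
  have cross: "integrable M (\<lambda>w. (11/8) * (h w \<bullet> v w))"
    by (rule integrable_mult_right) (rule sq_integrable_inner[OF assms(3,2)])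
  have velocity: "integrable M (\<lambda>w. (1/2) * (norm (v w))\<^sup>2)"
    by (rule integrable_mult_right) (use assms(2) in \<open>simp add: sq_integrable_def\<close>)
  show ?thesis
    unfolding lyap_def
    by (rule Bochner_Integration.integrable_add
        [OF Bochner_Integration.integrable_diff[OF position cross] velocity])
qed

lemma (in sigma_finite_subalgebra) nn_integral_nn_cond_exp:
  assumes [measurable]: "f \<in> borel_measurable M"
  shows "(\<integral>\<^sup>+ w. nn_cond_exp M F f w \<partial>M) = (\<integral>\<^sup>+ w. f w \<partial>M)"
  using nn_cond_exp_intg[of "\<lambda>_. 1" f] by simp

text \<open>Conditionally centered noise is orthogonal to everything that is known beforehand. As centering
is required of each coordinate, the inner product is treated as a sum over coordinates.\<close>
lemma (in sigma_finite_subalgebra) integral_inner_centered: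
  fixes e h :: "'a \<Rightarrow> real^'p"
  assumes e: "sq_integrable M e" and h: "sq_integrable M h" and hF: "h \<in> borel_measurable F"
    and centered: "\<And>j. AE w in M. real_cond_exp M F (\<lambda>w. e w $ j) w = 0"
  shows "(\<integral>w. e w \<bullet> h w \<partial>M) = 0"
proof -
  have meas: "(\<lambda>w. e w $ j) \<in> borel_measurable M" "(\<lambda>w. h w $ j) \<in> borel_measurable F" for j
  proof -
    have *: "(\<lambda>y. y $ j) \<in> borel_measurable (borel :: (real^'p) measure)"
      by (intro borel_measurable_continuous_onI continuous_intros)
    show "(\<lambda>w. e w $ j) \<in> borel_measurable M"
      using e by (intro measurable_compose[OF _ *]) (simp add: sq_integrable_def)
    show "(\<lambda>w. h w $ j) \<in> borel_measurable F"
      by (rule measurable_compose[OF hF *])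
  qed
  have sq: "sq_integrable M (\<lambda>w. y w $ j)" if "sq_integrable M y" "(\<lambda>w. y w $ j) \<in> borel_measurable M"
    for y :: "'a \<Rightarrow> real^'p" and j
    using sq_integrable_bounded_by[OF that, of 1] by (simp add: component_le_norm_cart)
  have int: "integrable M (\<lambda>w. h w $ j * e w $ j)" for j
    using sq_integrable_inner[OF sq[OF h measurable_from_subalg[OF subalg meas(2)]] sq[OF e meas(1)]]
    by simp
  have "(\<integral>w. h w $ j * e w $ j \<partial>M) = 0" for j
  proof -
    have "(\<integral>w. h w $ j * e w $ j \<partial>M) = (\<integral>w. h w $ j * real_cond_exp M F (\<lambda>w. e w $ j) w \<partial>M)"
      by (rule real_cond_exp_intg(2)[symmetric]) (use int meas in auto)
    also have "\<dots> = (\<integral>w. 0 \<partial>M)"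
      by (rule integral_cong_AE) (use centered[of j] meas in \<open>auto intro: measurable_from_subalg[OF subalg]\<close>)
    finally show ?thesis by simp
  qed
  then show ?thesis
    using int by (simp add: inner_vec_def mult.commute)
qed

section \<open>Averages of maps that are jointly cocoercive\<close>

text \<open>Jensen's inequality: averaging cannot increase the mean squared difference. With it, the
averaged inequality yields cocoercivity of the average itself.\<close>
lemma norm_avg_map_diff_le:
  assumes "1 \<le> n"
  shows "(norm (avg_map n G x - avg_map n G y))\<^sup>2 \<le> (1 / real n) * (\<Sum>i = 1..n. (norm (G i x - G i y))\<^sup>2)"
proof -
  have n: "0 < real n" using assms by simp
  have "norm (avg_map n G x - avg_map n G y) = (1 / real n) * norm (\<Sum>i = 1..n. G i x - G i y)"
    by (simp add: avg_map_def sum_subtractf flip: scaleR_diff_right)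
  also have "\<dots> \<le> (1 / real n) * (\<Sum>i = 1..n. norm (G i x - G i y))"
    by (intro mult_left_mono norm_sum) simp
  finally have "(norm (avg_map n G x - avg_map n G y))\<^sup>2
      \<le> ((1 / real n) * (\<Sum>i = 1..n. norm (G i x - G i y)))\<^sup>2"
    by (intro power_mono) auto
  also have "\<dots> = (1 / real n)\<^sup>2 * (\<Sum>i = 1..n. norm (G i x - G i y))\<^sup>2"
    by (rule power_mult_distrib)
  also have "\<dots> \<le> (1 / real n)\<^sup>2 * (real n * (\<Sum>i = 1..n. (norm (G i x - G i y))\<^sup>2))"
    using sum_squared_le_sum_of_squares[of "\<lambda>i. norm (G i x - G i y)" "{1..n}"]
    by (intro mult_left_mono) (auto simp: mult.commute)
  also have "\<dots> = (1 / real n) * (\<Sum>i = 1..n. (norm (G i x - G i y))\<^sup>2)"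
    using n by (simp add: power2_eq_square)
  finally show ?thesis .
qed

lemma inner_avg_map_diff:
  "(avg_map n G x - avg_map n G y) \<bullet> z = (1 / real n) * (\<Sum>i = 1..n. (G i x - G i y) \<bullet> z)"
  by (simp add: avg_map_def inner_sum_left sum_subtractf inner_diff_left flip: scaleR_diff_right)

lemma avg_cocoercive_inner:
  assumes "avg_cocoercive n G L" and "0 < L"
  shows "(1 / real n) * (\<Sum>i = 1..n. (norm (G i x - G i y))\<^sup>2)
    \<le> L * ((avg_map n G x - avg_map n G y) \<bullet> (x - y))"
proof -
  have "(1/L) * ((1 / real n) * (\<Sum>i = 1..n. (norm (G i x - G i y))\<^sup>2))
    \<le> (avg_map n G x - avg_map n G y) \<bullet> (x - y)"
    using assms(1) unfolding avg_cocoercive_def inner_avg_map_diff by blast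
  from mult_left_mono[OF this, of L] show ?thesis
    using assms(2) by simp
qed

text \<open>Cauchy-Schwarz absorbs one factor of the difference of the averages.\<close>
lemma avg_cocoercive_lipschitz:
  assumes "avg_cocoercive n G L" and "0 < L" and "1 \<le> n"
  shows "norm (avg_map n G x - avg_map n G y) \<le> L * norm (x - y)"
    and "(1 / real n) * (\<Sum>i = 1..n. (norm (G i x - G i y))\<^sup>2) \<le> (L * norm (x - y))\<^sup>2"
proof -
  let ?d = "avg_map n G x - avg_map n G y"
  let ?U = "(1 / real n) * (\<Sum>i = 1..n. (norm (G i x - G i y))\<^sup>2)"
  have U: "?U \<le> L * (norm ?d * norm (x - y))"
    using avg_cocoercive_inner[OF assms(1,2), of x y] norm_cauchy_schwarz[of ?d "x - y"] assms(2)
    by (meson dual_order.trans less_imp_le mult_left_mono)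
  have "norm ?d * norm ?d \<le> norm ?d * (L * norm (x - y))"
    using norm_avg_map_diff_le[OF assms(3), of G x y] U by (simp add: power2_eq_square mult_ac)
  then show lip: "norm ?d \<le> L * norm (x - y)"
    using assms(2) by (cases "norm ?d = 0") (auto simp: mult_le_cancel_left)
  have "L * (norm ?d * norm (x - y)) \<le> L * ((L * norm (x - y)) * norm (x - y))"
    using lip assms(2) by (intro mult_left_mono mult_right_mono) auto
  then show "?U \<le> (L * norm (x - y))\<^sup>2"
    using U by (simp add: power2_eq_square mult_ac)
qed

text \<open>Each component is Lipschitz, with a constant that depends on \<open>n\<close>, because its squared difference is one
summand of the average. This makes the quantities
\<open>U\<^sub>k\<close> measurable.\<close>
lemma avg_cocoercive_continuous:
  assumes "avg_cocoercive n G L" and "0 < L" and "1 \<le> n" and i: "i \<in> {1..n}"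
  shows "continuous_on UNIV (G i)"
proof -
  have "norm (G i x - G i y) \<le> sqrt (real n) * L * norm (x - y)" for x y
  proof -
    have "(norm (G i x - G i y))\<^sup>2 \<le> (\<Sum>i = 1..n. (norm (G i x - G i y))\<^sup>2)"
      by (rule member_le_sum[OF i]) auto
    also have "\<dots> \<le> real n * (L * norm (x - y))\<^sup>2"
      using avg_cocoercive_lipschitz(2)[OF assms(1-3), of x y] assms(3) by (simp add: field_simps)
    also have "\<dots> = (sqrt (real n) * L * norm (x - y))\<^sup>2"
      by (simp add: power_mult_distrib)
    finally show ?thesis
      by (rule power2_le_imp_le) (use assms(2) in auto)
  qed
  then have "(sqrt (real n) * L)-lipschitz_on UNIV (G i)"
    using assms(2) by (auto simp: lipschitz_on_def dist_norm)
  then show ?thesis by (rule lipschitz_on_continuous_on)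
qed

section \<open>Decay of the expected potential along a run\<close>

text \<open>A run of the method with momentum \<open>1/3\<close> and reflection \<open>1/2\<close>. The estimator conditions appear with
\<open>1 / (1 - 1/2)\<^sup>2 = 4\<close> inserted, and the
step-size limit is replaced by the inequalities on \<open>\<beta>\<close> and \<open>\<omega>\<close> that it entails.\<close>
locale vfkm_run = prob_space P for P :: "'w measure" +
  fixes F :: "nat \<Rightarrow> 'w measure" and n :: nat and G :: "nat \<Rightarrow> real^'p \<Rightarrow> real^'p"
    and L \<sigma> \<beta> \<omega> \<rho> \<Theta> \<Theta>h :: real and xs x0 :: "real^'p"
    and x St :: "nat \<Rightarrow> 'w \<Rightarrow> real^'p" and \<Delta> :: "nat \<Rightarrow> 'w \<Rightarrow> real"
  assumes n: "1 \<le> n" and L: "0 < L" and coc: "avg_cocoercive n G L"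
    and sqm: "strongly_quasi_monotone_at (avg_map n G) \<sigma> xs"
    and filt: "algorithm_filtration P F x"
    and run: "vfkm P (avg_map n G) (\<lambda>_. 1/3) (\<lambda>_. 1/2) (\<lambda>_. \<beta>) x0 x St"
    and \<rho>: "0 < \<rho>" "\<rho> < 1" and \<Theta>: "0 < \<Theta>" "0 \<le> \<Theta>h"
    and St_measurable: "\<And>k. St k \<in> borel_measurable P"
    and \<Delta>_measurable: "\<And>k. \<Delta> k \<in> borel_measurable P"
    and \<Delta>_nonneg: "\<And>k. AE w in P. 0 \<le> \<Delta> k w"
    and \<Delta>_0: "AE w in P. \<Delta> 0 w = 0"
    and unbiased: "\<And>k j. 1 \<le> k \<Longrightarrow> AE w in P.
      real_cond_exp P (F k) (\<lambda>w. (St k w - vfkm_S (avg_map n G) (\<lambda>_. 1/2) x k w) $ j) w = 0"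
    and variance: "\<And>k. 1 \<le> k \<Longrightarrow> AE w in P.
      nn_cond_exp P (F k) (\<lambda>w. ennreal ((norm (St k w - vfkm_S (avg_map n G) (\<lambda>_. 1/2) x k w))\<^sup>2)) w
        \<le> nn_cond_exp P (F k) (\<lambda>w. ennreal (\<Delta> k w)) w"
    and recursion: "\<And>k. 1 \<le> k \<Longrightarrow> AE w in P.
      4 * nn_cond_exp P (F k) (\<lambda>w. ennreal (\<Delta> k w)) w
        \<le> ennreal (4 * ((1 - \<rho>) * \<Delta> (k - 1) w + \<Theta> * vr_U n G x k w + \<Theta>h * vr_U n G x (k - 1) w))"
    and \<beta>: "0 < \<beta>" "\<beta> * L \<le> 1/2"
    and \<omega>: "0 \<le> \<omega>" "\<omega> \<le> 2/9" "(3/2) * \<omega> \<le> \<beta> * \<sigma>" "\<omega> < \<rho>"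
    and step: "L * \<beta> * (\<rho> - \<omega> + 2 * (\<Theta> + \<Theta>h)) \<le> \<rho> - \<omega>"
begin

definition T :: "real^'p \<Rightarrow> real^'p" where "T = avg_map n G"
definition deviation :: "nat \<Rightarrow> 'w \<Rightarrow> real^'p" where "deviation k w = x k w - xs"
definition incr :: "nat \<Rightarrow> 'w \<Rightarrow> real^'p" where "incr k w = x k w - x (k - 1) w"
definition scaled_op :: "nat \<Rightarrow> 'w \<Rightarrow> real^'p" where "scaled_op k w = \<beta> *\<^sub>R T (x k w)"
definition noise :: "nat \<Rightarrow> 'w \<Rightarrow> real^'p" where
  "noise k w = St k w - vfkm_S T (\<lambda>_. 1/2) x k w"
abbreviation U :: "nat \<Rightarrow> 'w \<Rightarrow> real" where "U \<equiv> vr_U n G x"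

lemma T_cocoercive:
  "(1 / real n) * (\<Sum>i = 1..n. (norm (G i y - G i z))\<^sup>2) \<le> L * ((T y - T z) \<bullet> (y - z))"
  "(norm (T y - T z))\<^sup>2 \<le> (1 / real n) * (\<Sum>i = 1..n. (norm (G i y - G i z))\<^sup>2)"
  "norm (T y - T z) \<le> L * norm (y - z)"
  using avg_cocoercive_inner[OF coc L] norm_avg_map_diff_le[OF n] avg_cocoercive_lipschitz(1)[OF coc L n]
  by (auto simp: T_def)

lemma T_xs: "T xs = 0"
  using sqm by (simp add: strongly_quasi_monotone_at_def zer_def T_def)

lemma T_cocoercive_xs: "(norm (T y))\<^sup>2 \<le> L * (T y \<bullet> (y - xs))"
  using T_cocoercive(1,2)[of y xs] by (simp add: T_xs)

lemma U_bounds: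
  "0 \<le> U k w"
  "(norm (T (x k w) - T (x (k - 1) w)))\<^sup>2 \<le> U k w"
  "U k w \<le> L * ((T (x k w) - T (x (k - 1) w)) \<bullet> incr k w)"
  "U k w \<le> (L * norm (incr k w))\<^sup>2"
  using T_cocoercive(1,2)[of "x k w" "x (k - 1) w"] avg_cocoercive_lipschitz(2)[OF coc L n]
  by (auto simp: vr_U_def incr_def intro!: sum_nonneg divide_nonneg_nonneg)

lemma subalg_F: "subalgebra P (F k)"
  using filt by (simp add: algorithm_filtration_def)

lemma cond_F: "sigma_finite_subalgebra P (F k)"
proof -
  interpret finite_measure_subalgebra P "F k"
    by unfold_locales (rule subalg_F)
  show ?thesis by unfold_locales
qed

lemma x_adapted: "x k \<in> borel_measurable (F k)" "x (k - 1) \<in> borel_measurable (F k)"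
proof -
  show "x k \<in> borel_measurable (F k)" using filt by (simp add: algorithm_filtration_def)
  have "filtration (space P) F" using filt by (simp add: algorithm_filtration_def)
  then have "subalgebra (F k) (F (k - 1))"
    by (simp add: subalgebra_def filtration_def)
  then show "x (k - 1) \<in> borel_measurable (F k)"
    by (rule measurable_from_subalg) (use filt in \<open>simp add: algorithm_filtration_def\<close>)
qed

lemma T_measurable [measurable]: "T \<in> borel_measurable borel"
proof -
  have "L-lipschitz_on UNIV T"
    using T_cocoercive(3) L by (auto simp: lipschitz_on_def dist_norm)
  then show ?thesis
    by (intro borel_measurable_continuous_onI lipschitz_on_continuous_on)
qed

lemma adapted [measurable]:
  "deviation k \<in> borel_measurable (F k)" "incr k \<in> borel_measurable (F k)"
  "scaled_op k \<in> borel_measurable (F k)" "scaled_op (k - 1) \<in> borel_measurable (F k)"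
proof -
  note [measurable] = x_adapted[of k]
  show "deviation k \<in> borel_measurable (F k)" unfolding deviation_def by measurable
  show "incr k \<in> borel_measurable (F k)" unfolding incr_def by measurable
  show "scaled_op k \<in> borel_measurable (F k)" unfolding scaled_op_def by measurable
  show "scaled_op (k - 1) \<in> borel_measurable (F k)" unfolding scaled_op_def by measurable
qed

lemma x_measurable [measurable]: "x k \<in> borel_measurable P"
  by (rule measurable_from_subalg[OF subalg_F x_adapted(1)])

lemma noise_measurable [measurable]: "noise k \<in> borel_measurable P"
proof -
  note [measurable] = St_measurable
  show ?thesis unfolding noise_def vfkm_S_def by measurable
qed

lemma U_measurable [measurable]: "U k \<in> borel_measurable P"
proof -
  have "(\<lambda>w. (norm (G i (x k w) - G i (x (k - 1) w)))\<^sup>2) \<in> borel_measurable P"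
    if "i \<in> {1..n}" for i
  proof -
    have [measurable]: "G i \<in> borel_measurable borel"
      by (intro borel_measurable_continuous_onI avg_cocoercive_continuous[OF coc L n that])
    show ?thesis by measurable
  qed
  then show ?thesis
    unfolding vr_U_def by (intro borel_measurable_times borel_measurable_sum) auto
qed

lemma integrable_U:
  assumes "sq_integrable P (incr k)"
  shows "integrable P (U k)"
proof (rule Bochner_Integration.integrable_bound)
  show "integrable P (\<lambda>w. L\<^sup>2 * (norm (incr k w))\<^sup>2)"
    using assms by (intro integrable_mult_right) (simp add: sq_integrable_def)
  show "AE w in P. norm (U k w) \<le> norm (L\<^sup>2 * (norm (incr k w))\<^sup>2)"
    using U_bounds(1,4)[of k] by (simp add: power_mult_distrib)
qed simp

lemma sq_integrable_scaled_op:
  assumes "sq_integrable P (deviation k)"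
  shows "sq_integrable P (scaled_op k)"
proof (rule sq_integrable_bounded_by[OF assms])
  show "scaled_op k \<in> borel_measurable P" unfolding scaled_op_def by measurable
  show "norm (scaled_op k w) \<le> (\<beta> * L) * norm (deviation k w)" for w
    using T_cocoercive(3)[of "x k w" xs] \<beta>(1) by (simp add: scaled_op_def deviation_def T_xs)
qed

text \<open>Integrating the conditional inequalities. They are stated for extended nonnegative
conditional expectations, so integrability of \<open>\<Delta>\<^sub>k\<close> and of the squared noise is a conclusion
here, inherited from the previous iteration. At \<open>k = 0\<close> the estimator
is exact, and the noise, \<open>\<Delta>\<^sub>0\<close> and \<open>U\<^sub>0\<close> all vanish.\<close>
lemma noise_second_moment:
  assumes incr: "sq_integrable P (incr k)" "sq_integrable P (incr (k - 1))"
    and \<Delta>: "integrable P (\<Delta> (k - 1))"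
  shows "sq_integrable P (noise k)" and "integrable P (\<Delta> k)"
    and "(\<integral>w. (norm (noise k w))\<^sup>2 \<partial>P) \<le> (\<integral>w. \<Delta> k w \<partial>P)"
    and "(\<integral>w. \<Delta> k w \<partial>P)
      \<le> (1 - \<rho>) * (\<integral>w. \<Delta> (k - 1) w \<partial>P) + \<Theta> * (\<integral>w. U k w \<partial>P) + \<Theta>h * (\<integral>w. U (k - 1) w \<partial>P)"
proof -
  have "sq_integrable P (noise k) \<and> integrable P (\<Delta> k)
    \<and> (\<integral>w. (norm (noise k w))\<^sup>2 \<partial>P) \<le> (\<integral>w. \<Delta> k w \<partial>P)
    \<and> (\<integral>w. \<Delta> k w \<partial>P)
      \<le> (1 - \<rho>) * (\<integral>w. \<Delta> (k - 1) w \<partial>P) + \<Theta> * (\<integral>w. U k w \<partial>P) + \<Theta>h * (\<integral>w. U (k - 1) w \<partial>P)"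
  proof (cases "k = 0")
    case True
    have noise0: "norm (noise 0 w) = 0" if "w \<in> space P" for w
      using run that by (auto simp: noise_def vfkm_def T_def)
    have "(\<integral>w. (norm (noise 0 w))\<^sup>2 \<partial>P) = 0"
      by (rule integral_eq_zero_AE) (auto intro!: AE_I2 simp: noise0)
    moreover have "(\<integral>w. \<Delta> 0 w \<partial>P) = 0"
      by (rule integral_eq_zero_AE[OF \<Delta>_0])
    moreover have "integrable P (\<lambda>w. (norm (noise 0 w))\<^sup>2) = integrable P (\<lambda>_. 0 :: real)"
      by (rule Bochner_Integration.integrable_cong) (auto simp: noise0)
    moreover have "(\<integral>w. U 0 w \<partial>P) = 0"
      by (simp add: vr_U_def)
    ultimately show ?thesis
      using True \<Delta> noise_measurable[of 0] by (simp add: sq_integrable_def)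
  next
    case False
    then have k: "1 \<le> k" by simp
    interpret cond: sigma_finite_subalgebra P "F k" by (rule cond_F)
    note [measurable] = \<Delta>_measurable
    define r where "r w = 4 * ((1 - \<rho>) * \<Delta> (k - 1) w + \<Theta> * U k w + \<Theta>h * U (k - 1) w)" for w
    have r: "integrable P r"
      unfolding r_def using \<Delta> integrable_U[OF incr(1)] integrable_U[OF incr(2)] by simp
    have r0: "AE w in P. 0 \<le> r w"
      using \<Delta>_nonneg[of "k - 1"]
    proof eventually_elim
      case (elim w)
      then show ?case unfolding r_def using \<rho> \<Theta> U_bounds(1) by simp
    qed
    have "4 * (\<integral>\<^sup>+ w. ennreal (\<Delta> k w) \<partial>P) = (\<integral>\<^sup>+ w. 4 * nn_cond_exp P (F k) (\<lambda>w. ennreal (\<Delta> k w)) w \<partial>P)"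
      by (simp add: nn_integral_cmult cond.nn_integral_nn_cond_exp)
    also have "\<dots> \<le> (\<integral>\<^sup>+ w. ennreal (r w) \<partial>P)"
      unfolding r_def by (rule nn_integral_mono_AE[OF recursion[OF k]])
    also have "\<dots> = ennreal (\<integral>w. r w \<partial>P)"
      by (rule nn_integral_eq_integral[OF r r0])
    finally have \<Delta>_le: "4 * (\<integral>\<^sup>+ w. ennreal (\<Delta> k w) \<partial>P) \<le> ennreal (\<integral>w. r w \<partial>P)" .
    have "(\<integral>\<^sup>+ w. ennreal (\<Delta> k w) \<partial>P) \<le> 4 * (\<integral>\<^sup>+ w. ennreal (\<Delta> k w) \<partial>P)"
      using mult_right_mono[of 1 4 "\<integral>\<^sup>+ w. ennreal (\<Delta> k w) \<partial>P"] by simp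
    also have "\<dots> < \<infinity>"
      using \<Delta>_le by (rule le_less_trans) simp
    finally have fin: "(\<integral>\<^sup>+ w. ennreal (\<Delta> k w) \<partial>P) < \<infinity>" .
    have int: "integrable P (\<Delta> k)"
      by (rule integrableI_nonneg[OF \<Delta>_measurable \<Delta>_nonneg fin])
    have \<Delta>_eq: "(\<integral>\<^sup>+ w. ennreal (\<Delta> k w) \<partial>P) = ennreal (\<integral>w. \<Delta> k w \<partial>P)"
      by (rule nn_integral_eq_integral[OF int \<Delta>_nonneg])
    have "ennreal (4 * (\<integral>w. \<Delta> k w \<partial>P)) \<le> ennreal (\<integral>w. r w \<partial>P)"
      using \<Delta>_le unfolding \<Delta>_eq by (simp add: ennreal_mult')
    then have "4 * (\<integral>w. \<Delta> k w \<partial>P) \<le> (\<integral>w. r w \<partial>P)"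
      by (subst (asm) ennreal_le_iff) (rule integral_nonneg_AE[OF r0])
    also have "(\<integral>w. r w \<partial>P)
        = 4 * ((1 - \<rho>) * (\<integral>w. \<Delta> (k - 1) w \<partial>P) + \<Theta> * (\<integral>w. U k w \<partial>P) + \<Theta>h * (\<integral>w. U (k - 1) w \<partial>P))"
      unfolding r_def using \<Delta> integrable_U[OF incr(1)] integrable_U[OF incr(2)] by simp
    finally have rec: "(\<integral>w. \<Delta> k w \<partial>P)
      \<le> (1 - \<rho>) * (\<integral>w. \<Delta> (k - 1) w \<partial>P) + \<Theta> * (\<integral>w. U k w \<partial>P) + \<Theta>h * (\<integral>w. U (k - 1) w \<partial>P)"
      by simp
    have "(\<integral>\<^sup>+ w. ennreal ((norm (noise k w))\<^sup>2) \<partial>P)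
        = (\<integral>\<^sup>+ w. nn_cond_exp P (F k) (\<lambda>w. ennreal ((norm (noise k w))\<^sup>2)) w \<partial>P)"
      by (rule cond.nn_integral_nn_cond_exp[symmetric]) simp
    also have "\<dots> \<le> (\<integral>\<^sup>+ w. nn_cond_exp P (F k) (\<lambda>w. ennreal (\<Delta> k w)) w \<partial>P)"
      unfolding noise_def T_def by (rule nn_integral_mono_AE[OF variance[OF k]])
    also have "\<dots> = ennreal (\<integral>w. \<Delta> k w \<partial>P)"
      by (simp add: cond.nn_integral_nn_cond_exp \<Delta>_eq)
    finally have e_le: "(\<integral>\<^sup>+ w. ennreal ((norm (noise k w))\<^sup>2) \<partial>P) \<le> ennreal (\<integral>w. \<Delta> k w \<partial>P)" .
    have e_int: "integrable P (\<lambda>w. (norm (noise k w))\<^sup>2)"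
      by (rule integrableI_nonneg) (use e_le in \<open>auto intro: le_less_trans\<close>)
    have "ennreal (\<integral>w. (norm (noise k w))\<^sup>2 \<partial>P) \<le> ennreal (\<integral>w. \<Delta> k w \<partial>P)"
      using e_le by (simp add: nn_integral_eq_integral[OF e_int])
    then have "(\<integral>w. (norm (noise k w))\<^sup>2 \<partial>P) \<le> (\<integral>w. \<Delta> k w \<partial>P)"
      by (subst (asm) ennreal_le_iff) (rule integral_nonneg_AE[OF \<Delta>_nonneg])
    then show ?thesis
      using int e_int rec noise_measurable[of k] by (simp add: sq_integrable_def)
  qed
  then show "sq_integrable P (noise k)" "integrable P (\<Delta> k)"
    "(\<integral>w. (norm (noise k w))\<^sup>2 \<partial>P) \<le> (\<integral>w. \<Delta> k w \<partial>P)"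
    "(\<integral>w. \<Delta> k w \<partial>P)
      \<le> (1 - \<rho>) * (\<integral>w. \<Delta> (k - 1) w \<partial>P) + \<Theta> * (\<integral>w. U k w \<partial>P) + \<Theta>h * (\<integral>w. U (k - 1) w \<partial>P)"
    by blast+
qed

lemma noise_orthogonal:
  assumes e: "sq_integrable P (noise k)" and h: "sq_integrable P h" "h \<in> borel_measurable (F k)"
  shows "(\<integral>w. noise k w \<bullet> h w \<partial>P) = 0"
proof (cases "k = 0")
  case True
  have "noise 0 w = 0" if "w \<in> space P" for w
    using run that by (auto simp: noise_def vfkm_def T_def)
  then show ?thesis
    using True by (intro integral_eq_zero_AE AE_I2) simp
next
  case False
  interpret cond: sigma_finite_subalgebra P "F k" by (rule cond_F)
  show ?thesis
    using unbiased[of k] False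
    by (intro cond.integral_inner_centered[OF e h]) (simp add: noise_def T_def)
qed


definition drift :: "nat \<Rightarrow> 'w \<Rightarrow> real^'p" where
  "drift k w = (1/3) *\<^sub>R incr k w - scaled_op k w + (1/2) *\<^sub>R scaled_op (k - 1) w"

lemma incr_Suc:
  assumes "w \<in> space P"
  shows "incr (Suc k) w = drift k w - \<beta> *\<^sub>R noise k w"
proof -
  have "x (Suc k) w = x k w + (1/3) *\<^sub>R (x k w - x (k - 1) w) - \<beta> *\<^sub>R St k w"
    using run assms unfolding vfkm_def by blast
  then show ?thesis
    unfolding incr_def drift_def noise_def scaled_op_def vfkm_S_def
    by (simp add: algebra_simps)
qed

lemma deviation_Suc: "deviation (Suc k) w = deviation k w + incr (Suc k) w"
  by (simp add: deviation_def incr_def)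

text \<open>Square integrability propagates along the run, but the second moment of the noise at iteration \<open>k\<close> depends on
the iterates \<open>k\<close>, \<open>k - 1\<close> and \<open>k - 2\<close>, so all earlier iterates are carried through the induction.\<close>
lemma sq_integrable_run:
  "sq_integrable P (deviation k)" "sq_integrable P (incr k)" "sq_integrable P (scaled_op k)"
  "integrable P (\<Delta> k)" "sq_integrable P (noise k)"
proof -
  have incr: "sq_integrable P (incr j)"
    if "sq_integrable P (deviation j)" "sq_integrable P (deviation (j - 1))" for j
  proof -
    have "(\<lambda>w. deviation j w - deviation (j - 1) w) = incr j"
      by (simp add: fun_eq_iff deviation_def incr_def)
    then show ?thesis using sq_integrable_diff[OF that] by simp
  qed
  have "(\<forall>j\<le>k. sq_integrable P (deviation j)) \<and> integrable P (\<Delta> (k - 1))" for k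
  proof (induction k)
    case 0
    have "sq_integrable P (deviation 0)"
    proof (rule sq_integrable_bounded_by)
      show "sq_integrable P (\<lambda>_. x0 - xs)" by (simp add: sq_integrable_def)
      show "deviation 0 \<in> borel_measurable P" unfolding deviation_def by measurable
      show "norm (deviation 0 w) \<le> 1 * norm (x0 - xs)" if "w \<in> space P" for w
        using run that by (simp add: deviation_def vfkm_def)
    qed
    moreover have "integrable P (\<Delta> 0) = integrable P (\<lambda>_. 0 :: real)"
      by (rule integrable_cong_AE) (use \<Delta>_measurable \<Delta>_0 in auto)
    ultimately show ?case by simp
  next
    case (Suc k)
    then have D: "sq_integrable P (deviation j)" if "j \<le> k" for j using that by blast
    have I: "sq_integrable P (incr k)" "sq_integrable P (incr (k - 1))"
      by (intro incr D; simp)+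
    note noise = noise_second_moment(1,2)[OF I conjunct2[OF Suc.IH]]
    have drift: "sq_integrable P (drift k)"
      unfolding drift_def
      by (intro sq_integrable_add sq_integrable_diff sq_integrable_scaleR sq_integrable_scaled_op I D) simp_all
    have "sq_integrable P (deviation (Suc k))"
    proof (rule sq_integrable_bounded_by)
      show "sq_integrable P (\<lambda>w. deviation k w + (drift k w - \<beta> *\<^sub>R noise k w))"
        by (intro sq_integrable_add sq_integrable_diff sq_integrable_scaleR drift noise D) simp
      show "deviation (Suc k) \<in> borel_measurable P" unfolding deviation_def by measurable
      show "norm (deviation (Suc k) w) \<le> 1 * norm (deviation k w + (drift k w - \<beta> *\<^sub>R noise k w))"
        if "w \<in> space P" for w
        by (simp add: deviation_Suc incr_Suc[OF that])
    qed
    then show ?case using D noise(2) by (auto simp: le_Suc_eq)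
  qed
  note all = this
  show D: "sq_integrable P (deviation k)" for k using all by blast
  show I: "sq_integrable P (incr k)" for k by (intro incr D)
  show "sq_integrable P (scaled_op k)" for k by (intro sq_integrable_scaled_op D)
  show \<Delta>: "integrable P (\<Delta> k)" for k using all[of "Suc k"] by simp
  show "sq_integrable P (noise k)" for k by (rule noise_second_moment(1)[OF I I \<Delta>])
qed

lemma sq_integrable_drift: "sq_integrable P (drift k)"
  unfolding drift_def
  by (intro sq_integrable_add sq_integrable_diff sq_integrable_scaleR sq_integrable_run)

definition expected_lyap :: "nat \<Rightarrow> real" where
  "expected_lyap k = (\<integral>w. lyap (deviation k w) (incr k w) (scaled_op (k - 1) w) \<partial>P)"

text \<open>What one noise-free step leaves over per unit of \<open>U\<^sub>k\<close>.\<close>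
definition gain :: real where "gain = (11/8) * (\<beta> / L - \<beta>\<^sup>2)"

text \<open>\<open>\<beta> L \<le> 1/2\<close> is what makes the constant \<open>2\<close> in the deterministic lemma available.\<close>
lemma lyap_drift_le:
  "lyap (deviation k w + drift k w) (drift k w) (scaled_op k w) + gain * U k w
    \<le> (1 - \<omega>) * lyap (deviation k w) (incr k w) (scaled_op (k - 1) w)"
proof -
  have y: "2 * \<beta>\<^sup>2 \<le> \<beta> / L"
    using mult_left_mono[OF \<beta>(2), of \<beta>] \<beta>(1) L by (simp add: power2_eq_square field_simps)
  have inc: "(\<beta> / L) * U k w \<le> (scaled_op k w - scaled_op (k - 1) w) \<bullet> incr k w"
    using mult_left_mono[OF U_bounds(3)[of k w], of "\<beta> / L"] \<beta>(1) L
    by (simp add: scaled_op_def flip: scaleR_diff_right)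
  have lip: "(norm (scaled_op k w - scaled_op (k - 1) w))\<^sup>2 \<le> \<beta>\<^sup>2 * U k w"
    using mult_left_mono[OF U_bounds(2)[of k w], of "\<beta>\<^sup>2"]
    by (simp add: scaled_op_def power_mult_distrib flip: scaleR_diff_right)
  have mono: "(3/2) * \<omega> * (norm (deviation k w))\<^sup>2 \<le> scaled_op k w \<bullet> deviation k w"
  proof -
    have "\<sigma> * (norm (deviation k w))\<^sup>2 \<le> T (x k w) \<bullet> deviation k w"
      using sqm by (simp add: strongly_quasi_monotone_at_def T_def deviation_def)
    from mult_left_mono[OF this, of \<beta>] have "\<beta> * \<sigma> * (norm (deviation k w))\<^sup>2 \<le> scaled_op k w \<bullet> deviation k w"
      using \<beta>(1) by (simp add: scaled_op_def mult.assoc)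
    moreover have "(3/2) * \<omega> * (norm (deviation k w))\<^sup>2 \<le> \<beta> * \<sigma> * (norm (deviation k w))\<^sup>2"
      by (intro mult_right_mono \<omega>) simp
    ultimately show ?thesis by linarith
  qed
  have coc: "2 * (norm (scaled_op k w))\<^sup>2 \<le> scaled_op k w \<bullet> deviation k w"
  proof -
    have "2 * (norm (scaled_op k w))\<^sup>2 = 2 * \<beta>\<^sup>2 * (norm (T (x k w)))\<^sup>2"
      by (simp add: scaled_op_def power_mult_distrib)
    also have "\<dots> \<le> (\<beta> / L) * (norm (T (x k w)))\<^sup>2"
      by (intro mult_right_mono y) simp
    also have "\<dots> \<le> (\<beta> / L) * (L * (T (x k w) \<bullet> deviation k w))"
      using T_cocoercive_xs[of "x k w"] \<beta>(1) L unfolding deviation_def by (intro mult_left_mono) auto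
    finally show ?thesis using L by (simp add: scaled_op_def)
  qed
  have "2 * (\<beta>\<^sup>2 * U k w) \<le> (\<beta> / L) * U k w"
    using mult_right_mono[OF y U_bounds(1)[of k w]] by simp
  from lyap_decrease[OF \<omega>(1,2) mono coc inc this lip]
  show ?thesis by (simp only: drift_def gain_def mult.assoc left_diff_distrib)
qed

text \<open>The next state is the noise-free step plus a noise term; its linear part has mean zero, because
the vector \<open>z\<close> it is paired with is known before the estimator is drawn.\<close>
lemma expected_lyap_Suc_le:
  "expected_lyap (Suc k) + gain * (\<integral>w. U k w \<partial>P)
    \<le> (1 - \<omega>) * expected_lyap k + (11/4) * \<beta>\<^sup>2 * (\<integral>w. \<Delta> k w \<partial>P)"
proof -
  define z where "z w = 3 *\<^sub>R deviation k w + (11/2) *\<^sub>R drift k w + (7/8) *\<^sub>R scaled_op k w" for w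
  define D where "D w = lyap (deviation k w + drift k w) (drift k w) (scaled_op k w)" for w
  have z: "sq_integrable P z" "z \<in> borel_measurable (F k)"
    unfolding z_def
    by (intro sq_integrable_add sq_integrable_scaleR sq_integrable_run sq_integrable_drift)
      (unfold drift_def, measurable)
  have D: "integrable P D"
    unfolding D_def by (intro sq_integrable_lyap sq_integrable_add sq_integrable_run sq_integrable_drift)
  note N = sq_integrable_run(5)[of k]
  have zint: "integrable P (\<lambda>w. noise k w \<bullet> z w)" by (rule sq_integrable_inner[OF N z(1)])
  have nint: "integrable P (\<lambda>w. (norm (noise k w))\<^sup>2)" using N by (simp add: sq_integrable_def)
  have Uint: "integrable P (U k)" by (rule integrable_U[OF sq_integrable_run(2)])
  have "expected_lyap (Suc k) = (\<integral>w. D w - \<beta> * (noise k w \<bullet> z w) + (11/4) * \<beta>\<^sup>2 * (norm (noise k w))\<^sup>2 \<partial>P)"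
    unfolding expected_lyap_def
  proof (rule Bochner_Integration.integral_cong)
    fix w assume "w \<in> space P"
    then show "lyap (deviation (Suc k) w) (incr (Suc k) w) (scaled_op (Suc k - 1) w)
        = D w - \<beta> * (noise k w \<bullet> z w) + (11/4) * \<beta>\<^sup>2 * (norm (noise k w))\<^sup>2"
      unfolding D_def z_def deviation_Suc incr_Suc[OF \<open>w \<in> space P\<close>] lyap_noise
      by (simp add: power_mult_distrib)
  qed simp
  also have "\<dots> = (\<integral>w. D w \<partial>P) + (11/4) * \<beta>\<^sup>2 * (\<integral>w. (norm (noise k w))\<^sup>2 \<partial>P)"
    using D zint nint noise_orthogonal[OF N z] by simp
  also have "\<dots> \<le> (\<integral>w. D w \<partial>P) + (11/4) * \<beta>\<^sup>2 * (\<integral>w. \<Delta> k w \<partial>P)"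
    using noise_second_moment(3)[OF sq_integrable_run(2,2,4), of k]
    by (intro add_left_mono mult_left_mono) auto
  finally have 1: "expected_lyap (Suc k) \<le> (\<integral>w. D w \<partial>P) + (11/4) * \<beta>\<^sup>2 * (\<integral>w. \<Delta> k w \<partial>P)" .
  have "(\<integral>w. D w + gain * U k w \<partial>P)
      \<le> (\<integral>w. (1 - \<omega>) * lyap (deviation k w) (incr k w) (scaled_op (k - 1) w) \<partial>P)"
  proof (rule integral_mono)
    show "integrable P (\<lambda>w. D w + gain * U k w)" using D Uint by simp
    show "integrable P (\<lambda>w. (1 - \<omega>) * lyap (deviation k w) (incr k w) (scaled_op (k - 1) w))"
      by (intro integrable_mult_right sq_integrable_lyap sq_integrable_run)
    show "D w + gain * U k w
        \<le> (1 - \<omega>) * lyap (deviation k w) (incr k w) (scaled_op (k - 1) w)" for w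
      unfolding D_def by (rule lyap_drift_le)
  qed
  then have "(\<integral>w. D w \<partial>P) + gain * (\<integral>w. U k w \<partial>P) \<le> (1 - \<omega>) * expected_lyap k"
    using D Uint by (simp add: expected_lyap_def)
  then show ?thesis using 1 by linarith
qed

text \<open>The solution of \<open>weight (1 - \<rho>) + 11/4 \<beta>\<^sup>2 = weight (1 - \<omega>)\<close>: with this weight on the
variance sequence, the fresh noise of an iteration and the recursion of \<open>\<Delta>\<^sub>k\<close> together contract by
exactly \<open>1 - \<omega>\<close>.\<close>
definition weight :: real where "weight = (11/4) * \<beta>\<^sup>2 / (\<rho> - \<omega>)"

definition potential :: "nat \<Rightarrow> real" where
  "potential k = expected_lyap k + weight * ((1 - \<rho>) * (\<integral>w. \<Delta> (k - 1) w \<partial>P) + \<Theta>h * (\<integral>w. U (k - 1) w \<partial>P))"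

lemma weight_pos: "0 < weight"
  using \<beta> \<omega> by (simp add: weight_def)

text \<open>This is the step-size inequality multiplied by \<open>11/8 \<beta> / L\<close> and divided by \<open>\<rho> - \<omega>\<close>.\<close>
lemma weight_budget: "weight * (\<Theta> + \<Theta>h) \<le> gain"
proof -
  have "(11/8) * \<beta> / L * (L * \<beta> * (\<rho> - \<omega> + 2 * (\<Theta> + \<Theta>h))) \<le> (11/8) * \<beta> / L * (\<rho> - \<omega>)"
    using step \<beta>(1) L by (intro mult_left_mono) auto
  moreover have "(11/8) * \<beta> / L * (L * \<beta> * (\<rho> - \<omega> + 2 * (\<Theta> + \<Theta>h)))
      = (11/8) * \<beta>\<^sup>2 * (\<rho> - \<omega> + 2 * (\<Theta> + \<Theta>h))"
    using L by (simp add: power2_eq_square)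
  ultimately have "(11/4) * \<beta>\<^sup>2 * (\<Theta> + \<Theta>h) \<le> gain * (\<rho> - \<omega>)"
    unfolding gain_def by argo
  then have "(11/4) * \<beta>\<^sup>2 * (\<Theta> + \<Theta>h) / (\<rho> - \<omega>) \<le> gain"
    using \<omega>(4) by (subst pos_divide_le_eq) auto
  then show ?thesis by (simp add: weight_def)
qed

lemma potential_Suc_le: "potential (Suc k) \<le> (1 - \<omega>) * potential k"
proof -
  define d d' u u' where "d = (\<integral>w. \<Delta> k w \<partial>P)" and "d' = (\<integral>w. \<Delta> (k - 1) w \<partial>P)"
    and "u = (\<integral>w. U k w \<partial>P)" and "u' = (\<integral>w. U (k - 1) w \<partial>P)"
  have u: "0 \<le> u" unfolding u_def using U_bounds(1) by simp
  have w: "(11/4) * \<beta>\<^sup>2 = weight * (\<rho> - \<omega>)"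
    using \<omega>(4) by (intro nonzero_eq_divide_eq[THEN iffD1, OF _ weight_def, symmetric]) simp
  have "d \<le> (1 - \<rho>) * d' + \<Theta> * u + \<Theta>h * u'"
    using noise_second_moment(4)[OF sq_integrable_run(2,2,4), of k] by (simp add: d_def d'_def u_def u'_def)
  then have rec: "weight * (1 - \<omega>) * d \<le> weight * (1 - \<omega>) * ((1 - \<rho>) * d' + \<Theta> * u + \<Theta>h * u')"
    using weight_pos \<omega>(2) by (intro mult_left_mono) auto
  have "weight * (1 - \<omega>) * (\<Theta> * u) \<le> weight * (\<Theta> * u)"
    using weight_pos \<omega>(1) \<Theta>(1) u by (intro mult_right_mono) (auto simp: mult_le_cancel_left1)
  moreover have "weight * (\<Theta> + \<Theta>h) * u \<le> gain * u"
    by (rule mult_right_mono[OF weight_budget u])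
  ultimately have budget: "weight * (1 - \<omega>) * (\<Theta> * u) + weight * (\<Theta>h * u) \<le> gain * u"
    by (simp add: algebra_simps)
  have "potential (Suc k) = expected_lyap (Suc k) + weight * ((1 - \<rho>) * d + \<Theta>h * u)"
    by (simp add: potential_def d_def u_def)
  also have "\<dots> \<le> (1 - \<omega>) * expected_lyap k + weight * (\<rho> - \<omega>) * d - gain * u
      + weight * ((1 - \<rho>) * d + \<Theta>h * u)"
    using expected_lyap_Suc_le[of k, unfolded w, folded d_def u_def] by linarith
  also have "\<dots> = (1 - \<omega>) * expected_lyap k + weight * (1 - \<omega>) * d - gain * u + weight * (\<Theta>h * u)"
    by (simp add: algebra_simps)
  also have "\<dots> \<le> (1 - \<omega>) * expected_lyap k + weight * (1 - \<omega>) * ((1 - \<rho>) * d' + \<Theta>h * u')"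
  proof -
    have "weight * (1 - \<omega>) * ((1 - \<rho>) * d' + \<Theta> * u + \<Theta>h * u')
      = weight * (1 - \<omega>) * ((1 - \<rho>) * d' + \<Theta>h * u') + weight * (1 - \<omega>) * (\<Theta> * u)"
      by (simp add: algebra_simps)
    then show ?thesis using rec budget by linarith
  qed
  also have "\<dots> = (1 - \<omega>) * potential k"
    by (simp add: potential_def d'_def u'_def algebra_simps)
  finally show ?thesis .
qed

lemma potential_0_le: "potential 0 \<le> 2 * (1 + 2 * L\<^sup>2 * \<beta>\<^sup>2) * (norm (x0 - xs))\<^sup>2"
proof -
  have "lyap (deviation 0 w) (incr 0 w) (scaled_op 0 w) = lyap (x0 - xs) 0 (\<beta> *\<^sub>R T x0)"
    if "w \<in> space P" for w
    using run that by (simp add: deviation_def incr_def scaled_op_def vfkm_def)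
  then have "expected_lyap 0 = (\<integral>w. lyap (x0 - xs) 0 (\<beta> *\<^sub>R T x0) \<partial>P)"
    unfolding expected_lyap_def by (intro Bochner_Integration.integral_cong) auto
  then have "expected_lyap 0 = lyap (x0 - xs) 0 (\<beta> *\<^sub>R T x0)"
    by (simp add: prob_space)
  also have "\<dots> \<le> 2 * (1 + 2 * (\<beta> * L)\<^sup>2) * (norm (x0 - xs))\<^sup>2"
    using T_cocoercive(3)[of x0 xs] \<beta>(1) by (intro lyap_start) (simp add: T_xs)
  finally have "expected_lyap 0 \<le> 2 * (1 + 2 * L\<^sup>2 * \<beta>\<^sup>2) * (norm (x0 - xs))\<^sup>2"
    by (simp add: power_mult_distrib mult_ac)
  moreover have "(\<integral>w. \<Delta> 0 w \<partial>P) = 0" by (rule integral_eq_zero_AE[OF \<Delta>_0])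
  moreover have "(\<integral>w. U 0 w \<partial>P) = 0" by (simp add: vr_U_def)
  ultimately show ?thesis by (simp add: potential_def)
qed

lemma expected_distance_le_potential: "(\<integral>w. (norm (x k w - xs))\<^sup>2 \<partial>P) \<le> 2 * potential k"
proof -
  have "(norm (deviation k w))\<^sup>2 \<le> 2 * lyap (deviation k w) (incr k w) (scaled_op (k - 1) w)" for w
  proof (rule lyap_ge)
    have "2 * (norm (scaled_op (k - 1) w))\<^sup>2 = 2 * \<beta>\<^sup>2 * (norm (T (x (k - 1) w)))\<^sup>2"
      by (simp add: scaled_op_def power_mult_distrib)
    also have "\<dots> \<le> 2 * \<beta>\<^sup>2 * (L * (T (x (k - 1) w) \<bullet> (x (k - 1) w - xs)))"
      by (intro mult_left_mono T_cocoercive_xs) simp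
    also have "\<dots> = 2 * (\<beta> * L) * (\<beta> * (T (x (k - 1) w) \<bullet> (x (k - 1) w - xs)))"
      by (simp add: power2_eq_square mult_ac)
    also have "\<dots> \<le> 1 * (\<beta> * (T (x (k - 1) w) \<bullet> (x (k - 1) w - xs)))"
    proof (rule mult_right_mono)
      have "0 \<le> L * (T (x (k - 1) w) \<bullet> (x (k - 1) w - xs))"
        using T_cocoercive_xs[of "x (k - 1) w"] by (rule order.trans[rotated]) simp
      then show "0 \<le> \<beta> * (T (x (k - 1) w) \<bullet> (x (k - 1) w - xs))"
        using L \<beta>(1) by (simp add: zero_le_mult_iff)
    qed (use \<beta>(2) in simp)
    finally show "2 * (norm (scaled_op (k - 1) w))\<^sup>2 \<le> scaled_op (k - 1) w \<bullet> (deviation k w - incr k w)"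
      by (simp add: scaled_op_def deviation_def incr_def)
  qed
  then have "(\<integral>w. (norm (deviation k w))\<^sup>2 \<partial>P)
      \<le> (\<integral>w. 2 * lyap (deviation k w) (incr k w) (scaled_op (k - 1) w) \<partial>P)"
    using sq_integrable_lyap[OF sq_integrable_run(1,2,3), of k k "k - 1"] sq_integrable_run(1)[of k]
    by (intro integral_mono) (auto simp: sq_integrable_def)
  also have "\<dots> = 2 * expected_lyap k" by (simp add: expected_lyap_def)
  also have "expected_lyap k \<le> potential k"
  proof -
    have "0 \<le> (\<integral>w. \<Delta> (k - 1) w \<partial>P)" by (rule integral_nonneg_AE[OF \<Delta>_nonneg])
    moreover have "0 \<le> (\<integral>w. U (k - 1) w \<partial>P)" using U_bounds(1) by simp
    ultimately show ?thesis
      unfolding potential_def using weight_pos \<rho>(2) \<Theta>(2) by simp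
  qed
  finally show ?thesis by (simp add: deviation_def)
qed

theorem expected_distance_decay:
  "integrable P (\<lambda>w. (norm (x k w - xs))\<^sup>2)"
  "(\<integral>w. (norm (x k w - xs))\<^sup>2 \<partial>P) \<le> 4 * (1 + 2 * L\<^sup>2 * \<beta>\<^sup>2) * (1 - \<omega>) ^ k * (norm (x0 - xs))\<^sup>2"
proof -
  show "integrable P (\<lambda>w. (norm (x k w - xs))\<^sup>2)"
    using sq_integrable_run(1)[of k] by (simp add: sq_integrable_def deviation_def)
  have decay: "potential k \<le> (1 - \<omega>) ^ k * potential 0"
  proof (induction k)
    case (Suc k)
    have "potential (Suc k) \<le> (1 - \<omega>) * potential k" by (rule potential_Suc_le)
    also have "\<dots> \<le> (1 - \<omega>) * ((1 - \<omega>) ^ k * potential 0)"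
      using Suc.IH \<omega>(2) by (intro mult_left_mono) auto
    finally show ?case by (simp add: mult.assoc)
  qed simp
  have "(\<integral>w. (norm (x k w - xs))\<^sup>2 \<partial>P) \<le> 2 * ((1 - \<omega>) ^ k * potential 0)"
    using expected_distance_le_potential[of k] decay by linarith
  also have "\<dots> \<le> 2 * ((1 - \<omega>) ^ k * (2 * (1 + 2 * L\<^sup>2 * \<beta>\<^sup>2) * (norm (x0 - xs))\<^sup>2))"
    using \<omega>(2) by (intro mult_left_mono potential_0_le) auto
  finally show "(\<integral>w. (norm (x k w - xs))\<^sup>2 \<partial>P)
      \<le> 4 * (1 + 2 * L\<^sup>2 * \<beta>\<^sup>2) * (1 - \<omega>) ^ k * (norm (x0 - xs))\<^sup>2"
    by (simp add: algebra_simps)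
qed

end

section \<open>Iteration complexity\<close>

text \<open>Since \<open>(1 - \<omega>)\<^sup>j \<le> exp (- \<omega> j)\<close>, it suffices that \<open>\<omega> j\<close> exceeds
\<open>3 ln (1 / \<epsilon>)\<close>: two of these logarithms give \<open>\<epsilon>\<^sup>2\<close> and, as \<open>\<epsilon>\<close> is small relative
to \<open>R\<close>, the third absorbs the factor \<open>6 R\<^sup>2\<close>. Rounding up costs the remaining \<open>2\<close> in the
constant, since \<open>\<epsilon> < 1/2\<close> makes \<open>2 ln (1 / \<epsilon>)\<close> at least \<open>1\<close>.\<close>
lemma iterations_for_tolerance:
  fixes \<omega> R :: real and E :: "nat \<Rightarrow> real"
  assumes \<omega>: "0 < \<omega>" "\<omega> < 1/2" and decay: "\<And>j. E j \<le> 6 * (1 - \<omega>) ^ j * R\<^sup>2"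
    and \<epsilon>: "0 < \<epsilon>" "\<epsilon> < 1 / (2 + 6 * R\<^sup>2)"
  shows "\<exists>k. real k \<le> 5 * (1 / \<omega>) * ln (1 / \<epsilon>) \<and> (\<forall>j\<ge>k. E j \<le> \<epsilon>\<^sup>2)"
proof -
  define l where "l = ln (1 / \<epsilon>)"
  have "2 + 6 * R\<^sup>2 < 1 / \<epsilon>"
    using \<epsilon> by (simp add: field_simps add_pos_nonneg)
  then have inv: "2 \<le> 1 / \<epsilon>" "6 * R\<^sup>2 \<le> 1 / \<epsilon>" using zero_le_power2[of R] by linarith+
  have exp_l: "exp (- l) = \<epsilon>" using \<epsilon>(1) by (simp add: l_def ln_div)
  have "ln 2 \<le> l" unfolding l_def using inv(1) \<epsilon>(1) by (subst ln_le_cancel_iff) auto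
  then have l: "1/2 \<le> l" using ln2_ge_two_thirds by linarith
  define k where "k = nat \<lceil>3 * (1 / \<omega>) * l\<rceil>"
  have k: "3 * (1 / \<omega>) * l \<le> real k" unfolding k_def by linarith
  have "real k \<le> 3 * (1 / \<omega>) * l + 1"
  proof -
    have "0 \<le> 3 * (1 / \<omega>) * l" using \<omega> l by simp
    then show ?thesis unfolding k_def by linarith
  qed
  moreover have "1 \<le> 2 * (1 / \<omega>) * l"
    using mult_mono[of 2 "1 / \<omega>" "1/2" l] \<omega> l by (simp add: field_simps)
  ultimately have "real k \<le> 5 * (1 / \<omega>) * l" by linarith
  moreover have "E j \<le> \<epsilon>\<^sup>2" if "k \<le> j" for j
  proof -
    have "3 * (1 / \<omega>) * l \<le> real j" using k that by linarith
    then have wj: "3 * l \<le> \<omega> * real j" using \<omega> by (simp add: field_simps)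
    have "(1 - \<omega>) ^ j \<le> exp (- \<omega>) ^ j"
      using exp_ge_add_one_self[of "- \<omega>"] \<omega> by (intro power_mono) auto
    also have "\<dots> = exp (- (\<omega> * real j))"
      by (simp add: exp_of_nat_mult[symmetric] mult.commute)
    also have "\<dots> \<le> exp (3 * (- l))" using wj by simp
    also have "\<dots> = \<epsilon> ^ 3" using exp_of_nat_mult[of 3 "- l"] exp_l by simp
    finally have pow: "(1 - \<omega>) ^ j \<le> \<epsilon> ^ 3" .
    have "E j \<le> 6 * (1 - \<omega>) ^ j * R\<^sup>2" by (rule decay)
    also have "\<dots> = (6 * R\<^sup>2) * (1 - \<omega>) ^ j" by simp
    also have "\<dots> \<le> (1 / \<epsilon>) * \<epsilon> ^ 3"
      using inv(2) pow \<epsilon>(1) \<omega> by (intro mult_mono) auto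
    also have "\<dots> = \<epsilon>\<^sup>2" using \<epsilon>(1) by (simp add: power2_eq_square power3_eq_cube)
    finally show ?thesis .
  qed
  ultimately show ?thesis unfolding l_def by blast
qed

theorem theorem3:
  shows "\<exists>C>0. \<exists>\<epsilon>0 :: real \<Rightarrow> real. (\<forall>R. 0 < \<epsilon>0 R) \<and>
    (\<forall>(P :: 'w measure) (F :: nat \<Rightarrow> 'w measure) (n :: nat) (G :: nat \<Rightarrow> real^'p \<Rightarrow> real^'p)
      (L :: real) (\<sigma> :: real) (xstar :: real^'p) (x0 :: real^'p)
      (x :: nat \<Rightarrow> 'w \<Rightarrow> real^'p) (St :: nat \<Rightarrow> 'w \<Rightarrow> real^'p)
      (\<rho> :: real) (\<Theta> :: real) (\<Theta>h :: real)
      (\<kappa> :: real) (\<Gamma> :: real) (M :: real) (N :: real) (\<beta>bar :: real) (\<beta> :: real) (\<omega> :: real).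
       prob_space P \<longrightarrow> 1 \<le> n \<longrightarrow>
       0 < L \<longrightarrow> avg_cocoercive n G L \<longrightarrow>
       strongly_quasi_monotone_at (avg_map n G) \<sigma> xstar \<longrightarrow>
       algorithm_filtration P F x \<longrightarrow>
       vr_unbiased_estimator P F n G (\<lambda>_. 1/2) x St \<rho> \<Theta> \<Theta>h \<longrightarrow>
       vfkm P (avg_map n G) (\<lambda>_. 1/3) (\<lambda>_. 1/2) (\<lambda>_. \<beta>) x0 x St \<longrightarrow>
       \<kappa> = L / \<sigma> \<longrightarrow>
       \<Gamma> = \<rho> + 2 * (\<Theta> + \<Theta>h) \<longrightarrow>
       M = 2 * (2 * \<Gamma> - 1) * \<kappa> \<longrightarrow>
       N = 3 * \<Gamma> * \<kappa> + 2 * (1 - 2 * \<rho>) \<longrightarrow>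
       0 \<le> N\<^sup>2 + 12 * \<rho> * M \<longrightarrow> 2 * \<rho> < 1 \<longrightarrow>
       \<beta>bar = (1 / \<sigma>) * Min {3 / 5, 3 * \<rho> / (2 * (1 - 2 * \<rho>)), 1 / (2 * \<kappa>),
                               6 * \<rho> / (N + sqrt (N\<^sup>2 + 12 * \<rho> * M))} \<longrightarrow>
       \<omega> = 2 * \<beta> * \<sigma> / (3 + 4 * \<beta> * \<sigma>) \<longrightarrow>
       0 < \<beta>bar \<and>
       (0 < \<beta> \<longrightarrow> \<beta> < \<beta>bar \<longrightarrow>
          0 < \<omega> \<and> \<omega> < 1 / 2 \<and>
          (\<forall>k. integrable P (\<lambda>w. (norm (x k w - xstar))\<^sup>2) \<and>
               (\<integral>w. (norm (x k w - xstar))\<^sup>2 \<partial>P)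
                 \<le> 4 * (1 + 2 * L\<^sup>2 * \<beta>\<^sup>2) * (1 - \<omega>) ^ k * (norm (x0 - xstar))\<^sup>2) \<and>
          (\<forall>\<epsilon>>0. \<epsilon> < \<epsilon>0 (norm (x0 - xstar)) \<longrightarrow>
             (\<exists>k. real k \<le> C * (2 + 3 / (2 * \<beta> * \<sigma>)) * ln (1 / \<epsilon>) \<and>
                  (\<forall>j\<ge>k. (\<integral>w. (norm (x j w - xstar))\<^sup>2 \<partial>P) \<le> \<epsilon>\<^sup>2)))))"
proof (intro exI[of _ "5 :: real"] exI[of _ "\<lambda>R :: real. 1 / (2 + 6 * R\<^sup>2)"] conjI allI impI)
  show "(0 :: real) < 5" by simp
  show "0 < 1 / (2 + 6 * R\<^sup>2)" for R :: real
    by (simp add: add_pos_nonneg)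
next
  fix P :: "'w measure" and F n G L \<sigma> xstar x0 x St \<rho> \<Theta> \<Theta>h \<kappa> \<Gamma> M N \<beta>bar \<beta> \<omega>
  assume "0 < L" and sqm: "strongly_quasi_monotone_at (avg_map n G :: real^'p \<Rightarrow> real^'p) \<sigma> xstar"
    and est: "vr_unbiased_estimator (P :: 'w measure) F n G (\<lambda>_. 1/2) x St \<rho> \<Theta> \<Theta>h"
    and \<kappa>: "\<kappa> = L / \<sigma>" and \<Gamma>: "\<Gamma> = \<rho> + 2 * (\<Theta> + \<Theta>h)" and M: "M = 2 * (2 * \<Gamma> - 1) * \<kappa>"
    and N: "N = 3 * \<Gamma> * \<kappa> + 2 * (1 - 2 * \<rho>)" and disc: "0 \<le> N\<^sup>2 + 12 * \<rho> * M" and \<rho>: "2 * \<rho> < 1"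
    and \<beta>bar: "\<beta>bar = (1 / \<sigma>) * Min {3 / 5, 3 * \<rho> / (2 * (1 - 2 * \<rho>)), 1 / (2 * \<kappa>),
                               6 * \<rho> / (N + sqrt (N\<^sup>2 + 12 * \<rho> * M))}"
  have \<sigma>: "0 < \<sigma>" using sqm by (simp add: strongly_quasi_monotone_at_def)
  have pos: "0 < \<rho>" "0 < \<Theta>" "0 \<le> \<Theta>h" using est by (auto simp: vr_unbiased_estimator_def)
  have \<kappa>0: "0 < \<kappa>" using \<open>0 < L\<close> \<sigma> by (simp add: \<kappa>)
  have "0 < \<Gamma>" unfolding \<Gamma> using pos by simp
  then have "0 < N" unfolding N using \<kappa>0 \<rho> by (intro add_pos_pos mult_pos_pos) auto
  then have "0 < N + sqrt (N\<^sup>2 + 12 * \<rho> * M)" using disc by (intro add_pos_nonneg) auto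
  then show "0 < \<beta>bar" unfolding \<beta>bar using \<sigma> pos \<rho> \<kappa>0 by simp
next
  fix P :: "'w measure" and F n and G :: "nat \<Rightarrow> real^'p \<Rightarrow> real^'p"
    and L \<sigma> xstar x0 x St \<rho> \<Theta> \<Theta>h \<kappa> \<Gamma> M N \<beta>bar \<beta> \<omega>
  assume prob: "prob_space P" and n: "1 \<le> n" and L: "0 < L" and coc: "avg_cocoercive n G L"
    and sqm: "strongly_quasi_monotone_at (avg_map n G) \<sigma> xstar"
    and filt: "algorithm_filtration P F x"
    and est: "vr_unbiased_estimator P F n G (\<lambda>_. 1/2) x St \<rho> \<Theta> \<Theta>h"
    and run: "vfkm P (avg_map n G) (\<lambda>_. 1/3) (\<lambda>_. 1/2) (\<lambda>_. \<beta>) x0 x St"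
    and \<kappa>: "\<kappa> = L / \<sigma>" and \<Gamma>: "\<Gamma> = \<rho> + 2 * (\<Theta> + \<Theta>h)" and M: "M = 2 * (2 * \<Gamma> - 1) * \<kappa>"
    and N: "N = 3 * \<Gamma> * \<kappa> + 2 * (1 - 2 * \<rho>)" and disc: "0 \<le> N\<^sup>2 + 12 * \<rho> * M" and \<rho>2: "2 * \<rho> < 1"
    and \<beta>bar: "\<beta>bar = (1 / \<sigma>) * Min {3 / 5, 3 * \<rho> / (2 * (1 - 2 * \<rho>)), 1 / (2 * \<kappa>),
                               6 * \<rho> / (N + sqrt (N\<^sup>2 + 12 * \<rho> * M))}"
    and \<omega>_def: "\<omega> = 2 * \<beta> * \<sigma> / (3 + 4 * \<beta> * \<sigma>)" and \<beta>: "0 < \<beta>" "\<beta> < \<beta>bar"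
  have \<sigma>: "0 < \<sigma>" using sqm by (simp add: strongly_quasi_monotone_at_def)
  have pos: "0 < \<rho>" "\<rho> < 1" "0 < \<Theta>" "0 \<le> \<Theta>h" using est by (auto simp: vr_unbiased_estimator_def)
  have \<kappa>0: "0 < \<kappa>" using L \<sigma> by (simp add: \<kappa>)
  define s where "s = \<beta> * \<sigma>"
  have s0: "0 < s" using \<beta> \<sigma> by (simp add: s_def)
  have "s < Min {3 / 5, 3 * \<rho> / (2 * (1 - 2 * \<rho>)), 1 / (2 * \<kappa>), 6 * \<rho> / (N + sqrt (N\<^sup>2 + 12 * \<rho> * M))}"
    using mult_strict_right_mono[OF \<beta>(2) \<sigma>] \<sigma> by (simp add: s_def \<beta>bar)
  then have s: "s < 3 / 5" "s < 3 * \<rho> / (2 * (1 - 2 * \<rho>))" "s < 1 / (2 * \<kappa>)"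
    "s < 6 * \<rho> / (N + sqrt (N\<^sup>2 + 12 * \<rho> * M))"
    by simp_all
  have \<omega>: "\<omega> = 2 * s / (3 + 4 * s)" by (simp add: \<omega>_def s_def mult.assoc)
  have \<kappa>s: "\<kappa> * s = L * \<beta>" using \<sigma> by (simp add: \<kappa> s_def)
  have \<beta>L: "\<beta> * L \<le> 1/2" using s(3) \<kappa>0 \<kappa>s by (simp add: field_simps)
  have \<omega>0: "0 < \<omega>" unfolding \<omega> using s0 by simp
  have \<omega>1: "\<omega> \<le> 2/9" unfolding \<omega> using s0 s(1) by (simp add: field_simps)
  have \<omega>2: "(3/2) * \<omega> \<le> \<beta> * \<sigma>"
    unfolding \<omega> s_def[symmetric] using s0 by (simp add: field_simps)
  have \<Theta>s: "0 < \<Theta> + \<Theta>h" using pos by simp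
  note cond = step_size_condition[OF s0 \<kappa>0 pos(1) \<rho>2 \<Theta>s
      disc[unfolded N M \<Gamma>] s(4)[unfolded N M \<Gamma>] s(2) \<omega>]
  show "0 < \<omega>" by (rule \<omega>0)
  show "\<omega> < 1/2" using \<omega>1 by simp
  obtain \<Delta> where \<Delta>: "\<forall>k. \<Delta> k \<in> borel_measurable P" "\<forall>k. AE w in P. 0 \<le> \<Delta> k w" "AE w in P. \<Delta> 0 w = 0"
    and vr: "\<forall>k\<ge>1.
           (\<forall>j. AE w in P.
              real_cond_exp P (F k) (\<lambda>w. (St k w - vfkm_S (avg_map n G) (\<lambda>_. 1/2) x k w) $ j) w = 0) \<and>
           (AE w in P.
              nn_cond_exp P (F k)
                (\<lambda>w. ennreal ((norm (St k w - vfkm_S (avg_map n G) (\<lambda>_. 1/2) x k w))\<^sup>2)) w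
              \<le> nn_cond_exp P (F k) (\<lambda>w. ennreal (\<Delta> k w)) w) \<and>
           (AE w in P.
              ennreal (1 / (1 - 1/2)\<^sup>2) * nn_cond_exp P (F k) (\<lambda>w. ennreal (\<Delta> k w)) w
              \<le> ennreal ((1 - \<rho>) / (1 - 1/2)\<^sup>2 * \<Delta> (k - 1) w
                        + \<Theta> / (1 - 1/2)\<^sup>2 * vr_U n G x k w
                        + \<Theta>h / (1 - 1/2)\<^sup>2 * vr_U n G x (k - 1) w))"
    using est unfolding vr_unbiased_estimator_def by blast
  have four: "ennreal (1 / (1 - 1/2)\<^sup>2) = 4" by (simp add: power2_eq_square)
  have rhs: "(1 - \<rho>) / (1 - 1/2)\<^sup>2 * d + \<Theta> / (1 - 1/2)\<^sup>2 * u + \<Theta>h / (1 - 1/2)\<^sup>2 * u'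
      = 4 * ((1 - \<rho>) * d + \<Theta> * u + \<Theta>h * u')" for d u u'
    by (simp add: power2_eq_square algebra_simps)
  interpret run: vfkm_run P F n G L \<sigma> \<beta> \<omega> \<rho> \<Theta> \<Theta>h xstar x0 x St \<Delta>
  proof (intro vfkm_run.intro vfkm_run_axioms.intro)
    show "St k \<in> borel_measurable P" for k using est by (simp add: vr_unbiased_estimator_def)
    show "AE w in P. 4 * nn_cond_exp P (F k) (\<lambda>w. ennreal (\<Delta> k w)) w
        \<le> ennreal (4 * ((1 - \<rho>) * \<Delta> (k - 1) w + \<Theta> * vr_U n G x k w + \<Theta>h * vr_U n G x (k - 1) w))"
      if "1 \<le> k" for k
      using vr that unfolding four rhs by blast
    show "L * \<beta> * (\<rho> - \<omega> + 2 * (\<Theta> + \<Theta>h)) \<le> \<rho> - \<omega>" using cond(2) unfolding \<kappa>s .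
    show "0 \<le> \<omega>" using \<omega>0 by simp
  qed (use prob n L coc sqm filt run pos \<Delta> vr \<beta> \<beta>L \<omega>1 \<omega>2 cond(1) in \<open>(assumption | blast)+\<close>)
  show "integrable P (\<lambda>w. (norm (x k w - xstar))\<^sup>2)"
    and decay: "(\<integral>w. (norm (x k w - xstar))\<^sup>2 \<partial>P)
      \<le> 4 * (1 + 2 * L\<^sup>2 * \<beta>\<^sup>2) * (1 - \<omega>) ^ k * (norm (x0 - xstar))\<^sup>2" for k
    by (rule run.expected_distance_decay)+
  fix \<epsilon> :: real
  assume \<epsilon>: "0 < \<epsilon>" "\<epsilon> < 1 / (2 + 6 * (norm (x0 - xstar))\<^sup>2)"
  \<comment> \<open>As \<open>L \<beta> \<le> 1/2\<close>, the factor \<open>4 (1 + 2 L\<^sup>2 \<beta>\<^sup>2)\<close> is at most \<open>6\<close>, so the constant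
    in the iteration count does not depend on \<open>L\<close>.\<close>
  have "(L * \<beta>)\<^sup>2 \<le> (1/2)\<^sup>2"
    using \<beta>L L \<beta>(1) by (intro power_mono) (auto simp: mult.commute)
  then have "4 * (1 + 2 * L\<^sup>2 * \<beta>\<^sup>2) \<le> 6" by (simp add: power2_eq_square mult_ac)
  then have "4 * (1 + 2 * L\<^sup>2 * \<beta>\<^sup>2) * ((1 - \<omega>) ^ k * (norm (x0 - xstar))\<^sup>2)
      \<le> 6 * ((1 - \<omega>) ^ k * (norm (x0 - xstar))\<^sup>2)" for k
    using \<omega>1 by (intro mult_right_mono) auto
  then have decay6: "(\<integral>w. (norm (x k w - xstar))\<^sup>2 \<partial>P) \<le> 6 * (1 - \<omega>) ^ k * (norm (x0 - xstar))\<^sup>2" for k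
    using decay[of k] by (simp add: mult.assoc) (meson order.trans)
  have "1 / \<omega> = 2 + 3 / (2 * \<beta> * \<sigma>)"
    using s0 \<beta> \<sigma> unfolding \<omega>_def by (simp add: field_simps)
  then show "\<exists>k. real k \<le> 5 * (2 + 3 / (2 * \<beta> * \<sigma>)) * ln (1 / \<epsilon>) \<and>
      (\<forall>j\<ge>k. (\<integral>w. (norm (x j w - xstar))\<^sup>2 \<partial>P) \<le> \<epsilon>\<^sup>2)"
    using iterations_for_tolerance[OF \<omega>0 _ decay6 \<epsilon>] \<omega>1 by simp
qed

end
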